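(* For each $\epsilon > 0$, let $c = c(\epsilon) = 1/2 - \epsilon$. If there is an algorithm solving \textsc{Distinct Vectors} in time $2^{O(2^{ck})}\cdot \mathrm{poly}(n + m)$ on instances $(A,k)$ with $A \in \{0,1\}^{m \times n}$, then the Exponential Time Hypothesis is false.
   Context: \textsc{Distinct Vectors} is the decision problem: given a binary matrix $A \in \{0,1\}^{m \times n}$ (with $m$ rows and $n$ columns) and $k \in \mathbb{N}$, decide whether there is a subset $K \subseteq \{1,\dots,n\}$ of at most $k$ columns such that the rows of the submatrix $A[*,K]$ (the restriction of $A$ to the columns in $K$) are pairwise distinct. Here $\mathrm{poly}$ denotes an arbitrary fixed polynomial. The Exponential Time Hypothesis (ETH), in the form used (combined with the Sparsification Lemma), states: there exist constants $\delta, C > 0$ such that no algorithm, given a 3-CNF formula $\phi$ with $r$ variables and at most $C\cdot r$ clauses, runs in time $O(2^{\delta r})$ and correctly decides satisfiability of $\phi$. *)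

theory Defs
  imports
    "HOL-Library.Landau_Symbols"
    "HOL-Computational_Algebra.Polynomial"
    "Jordan_Normal_Form.DL_Submatrix"
begin

(* Algorithms are programs of a unit-cost random access machine.  A program names finitely
   many registers directly; the memory is addressed indirectly through registers.  The only
   arithmetic is addition, truncated subtraction and halving.  Without multiplication, t steps
   increase the bit length of the largest number by at most t (plus a constant depending on
   the program), so the machine and the multitape Turing machine simulate each other with
   polynomial overhead. *)

datatype instr =
    Const nat nat       (* Const d c: register d := c *)
  | Add nat nat nat     (* Add d a b: register d := register a + register b *)
  | Sub nat nat nat     (* Sub d a b: register d := register a - register b, truncated *)
  | Half nat nat        (* Half d a: register d := register a div 2 *)
  | Read nat nat        (* Read d a: register d := memory cell addressed by register a *)
  | Write nat nat       (* Write a b: memory cell addressed by register a := register b *)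
  | Jump nat            (* Jump l: continue at instruction l *)
  | JumpZero nat nat    (* JumpZero a l: continue at instruction l if register a is 0 *)

type_synonym program = "instr list"

datatype config = Config (pc: nat) (regs: "nat \<Rightarrow> nat") (mem: "nat \<Rightarrow> nat")

fun exec :: "instr \<Rightarrow> config \<Rightarrow> config" where
  "exec (Const d c) (Config i r h) = Config (Suc i) (r(d := c)) h"
| "exec (Add d a b) (Config i r h) = Config (Suc i) (r(d := r a + r b)) h"
| "exec (Sub d a b) (Config i r h) = Config (Suc i) (r(d := r a - r b)) h"
| "exec (Half d a) (Config i r h) = Config (Suc i) (r(d := r a div 2)) h"
| "exec (Read d a) (Config i r h) = Config (Suc i) (r(d := h (r a))) h"
| "exec (Write a b) (Config i r h) = Config (Suc i) r (h(r a := r b))"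
| "exec (Jump l) (Config i r h) = Config l r h"
| "exec (JumpZero a l) (Config i r h) = Config (if r a = 0 then l else Suc i) r h"

(* The machine halts when the program counter leaves the program. *)
definition halted :: "program \<Rightarrow> config \<Rightarrow> bool" where
  "halted P s \<longleftrightarrow> length P \<le> pc s"

definition step :: "program \<Rightarrow> config \<Rightarrow> config" where
  "step P s = (if halted P s then s else exec (P ! pc s) s)"

definition initial :: "nat list \<Rightarrow> config" where
  "initial w = Config 0 (\<lambda>_. 0) (\<lambda>a. if a < length w then w ! a else 0)"

(* Register 0 holds the answer: a nonzero value means "yes". *)
definition accepting :: "config \<Rightarrow> bool" where
  "accepting s \<longleftrightarrow> regs s 0 \<noteq> 0"

(* P decides the property Q on the (promised) instances in D, where instance x is given to P
   as the word enc x, and halts within T x steps. *)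
definition decides_in_time ::
    "program \<Rightarrow> ('i \<Rightarrow> nat list) \<Rightarrow> 'i set \<Rightarrow> ('i \<Rightarrow> bool) \<Rightarrow> ('i \<Rightarrow> real) \<Rightarrow> bool" where
  "decides_in_time P enc D Q T \<longleftrightarrow>
     (\<forall>x\<in>D. \<exists>t. real t \<le> T x \<and>
        (let s = (step P ^^ t) (initial (enc x)) in halted P s \<and> (accepting s \<longleftrightarrow> Q x)))"


(* An instance of Distinct Vectors is a pair (A, k).  Columns are numbered from 0. *)
definition distinct_vectors :: "bool mat \<times> nat \<Rightarrow> bool" where
  "distinct_vectors = (\<lambda>(A, k).
     \<exists>K \<subseteq> {..<dim_col A}. card K \<le> k \<and> distinct (rows (submatrix A UNIV K)))"

definition encode_dv :: "bool mat \<times> nat \<Rightarrow> nat list" where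
  "encode_dv = (\<lambda>(A, k). k # dim_row A # dim_col A #
     concat (map (\<lambda>i. map (\<lambda>j. of_bool (A $$ (i, j))) [0..<dim_col A]) [0..<dim_row A]))"


(* The literal (v, b) states that variable v has truth value b. *)
type_synonym literal = "nat \<times> bool"
type_synonym clause = "literal list"
type_synonym cnf = "clause list"

(* 3-CNF formulas over the r variables 0, ..., r - 1; clauses have at most three literals. *)
definition is_3cnf :: "nat \<Rightarrow> cnf \<Rightarrow> bool" where
  "is_3cnf r \<phi> \<longleftrightarrow> (\<forall>cl\<in>set \<phi>. length cl \<le> 3 \<and> (\<forall>(v, b)\<in>set cl. v < r))"

definition satisfiable :: "cnf \<Rightarrow> bool" where
  "satisfiable \<phi> \<longleftrightarrow> (\<exists>\<alpha> :: nat \<Rightarrow> bool. \<forall>cl\<in>set \<phi>. \<exists>(v, b)\<in>set cl. \<alpha> v = b)"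

definition encode_literal :: "literal \<Rightarrow> nat" where
  "encode_literal = (\<lambda>(v, b). 2 * v + of_bool b)"

definition encode_cnf :: "nat \<times> cnf \<Rightarrow> nat list" where
  "encode_cnf = (\<lambda>(r, \<phi>). r # length \<phi> #
     concat (map (\<lambda>cl. length cl # map encode_literal cl) \<phi>))"

definition ETH :: bool where
  "ETH \<longleftrightarrow> (\<exists>\<delta> > 0. \<exists>C > 0. \<not> (\<exists>P T.
     T \<in> O(\<lambda>r. 2 powr (\<delta> * real r)) \<and>
     decides_in_time P encode_cnf
       {(r, \<phi>). is_3cnf r \<phi> \<and> real (length \<phi>) \<le> C * real r}
       (\<lambda>(r, \<phi>). satisfiable \<phi>) (\<lambda>(r, \<phi>). T r)))"

end

theory Submission
  imports Defs "HOL-Real_Asymp.Real_Asymp"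
begin

text \<open>Split the \<open>r\<close> variables into a constant number \<open>g\<close> of groups.  There is one column for each
  assignment of each group, and there are \<open>b\<close> further columns, where \<open>2 ^ b\<close> exceeds the number of
  clauses by at least \<open>g\<close>.  For every \<open>b\<close>-bit tag there are two rows that carry the tag on the \<open>b\<close>
  columns.  One of them is 0 on the assignment columns, the other one marks there the assignments
  that satisfy the clause belonging to the tag.  The 0-rows force all \<open>b\<close> tag columns into a
  solution; if it has at most \<open>g + b\<close> columns, the others are one assignment for each group, and the
  pairs with equal tags are distinguished iff every clause is satisfied.

  The parameter is \<open>k = g + b = log r + O(1)\<close>, so \<open>2 powr (c * k) = O(sqrt r)\<close> already for
  \<open>c = 1 / 2\<close>, and the matrix has \<open>O(r * 2 powr (r / g))\<close> rows and columns; hence a large \<open>g\<close> brings the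
  total time below \<open>2 powr (\<delta> * r)\<close>.  The reduction is written in a small language of loops that is
  compiled to the machine; the output starts behind the input, so the given program is run with
  shifted memory addresses and renamed registers.\<close>

section \<open>A loop language for the machine\<close>

text \<open>Register \<open>rOne\<close> is overwritten with 1 by every loop iteration, \<open>rZero\<close> is never written and
  so keeps its initial value 0, and \<open>rOff\<close> holds the start of the output.\<close>

abbreviation (input) rOne :: nat where "rOne \<equiv> 2"
abbreviation (input) rR :: nat where "rR \<equiv> 3"
abbreviation (input) rOff :: nat where "rOff \<equiv> 4"
abbreviation (input) rTmp :: nat where "rTmp \<equiv> 5"
abbreviation (input) rM :: nat where "rM \<equiv> 6"
abbreviation (input) rO :: nat where "rO \<equiv> 7"
abbreviation (input) rH :: nat where "rH \<equiv> 8"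
abbreviation (input) rBits :: nat where "rBits \<equiv> 9"
abbreviation (input) rS :: nat where "rS \<equiv> 10"
abbreviation (input) rX :: nat where "rX \<equiv> 11"
abbreviation (input) rY :: nat where "rY \<equiv> 12"
abbreviation (input) rV :: nat where "rV \<equiv> 13"
abbreviation (input) rI :: nat where "rI \<equiv> 14"
abbreviation (input) rA :: nat where "rA \<equiv> 15"
abbreviation (input) rB :: nat where "rB \<equiv> 16"
abbreviation (input) rT :: nat where "rT \<equiv> 17"
abbreviation (input) rQ :: nat where "rQ \<equiv> 18"
abbreviation (input) rCnt :: nat where "rCnt \<equiv> 19"
abbreviation (input) rVal :: nat where "rVal \<equiv> 20"
abbreviation (input) rLen :: nat where "rLen \<equiv> 21"
abbreviation (input) rP :: nat where "rP \<equiv> 22"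
abbreviation (input) rLit :: nat where "rLit \<equiv> 23"
abbreviation (input) rPar :: nat where "rPar \<equiv> 24"
abbreviation (input) rZ :: nat where "rZ \<equiv> 25"
abbreviation (input) rZero :: nat where "rZero \<equiv> 28"

type_synonym store = "(nat \<Rightarrow> nat) \<times> (nat \<Rightarrow> nat)"

datatype cmd =
    Blk "instr list"
  | Seq cmd cmd  (infixr ";;" 60)
  | IfZ nat cmd cmd
  | Loop nat cmd

text \<open>The jumps get the identity as a dummy value; \<open>wf_cmd\<close> keeps them out of
  blocks.\<close>

fun effect :: "instr \<Rightarrow> store \<Rightarrow> store" where
  "effect (Const d c) (R, h) = (R(d := c), h)"
| "effect (Add d a b) (R, h) = (R(d := R a + R b), h)"
| "effect (Sub d a b) (R, h) = (R(d := R a - R b), h)"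
| "effect (Half d a) (R, h) = (R(d := R a div 2), h)"
| "effect (Read d a) (R, h) = (R(d := h (R a)), h)"
| "effect (Write a b) (R, h) = (R, h(R a := R b))"
| "effect (Jump l) s = s"
| "effect (JumpZero a l) s = s"

fun straight :: "instr \<Rightarrow> bool" where
  "straight (Jump l) = False"
| "straight (JumpZero a l) = False"
| "straight _ = True"

fun target :: "instr \<Rightarrow> nat set" where
  "target (Const d c) = {d}"
| "target (Add d a b) = {d}"
| "target (Sub d a b) = {d}"
| "target (Half d a) = {d}"
| "target (Read d a) = {d}"
| "target _ = {}"

primrec wregs :: "cmd \<Rightarrow> nat set" where
  "wregs (Blk is) = \<Union> (set (map target is))"
| "wregs (c1 ;; c2) = wregs c1 \<union> wregs c2"
| "wregs (IfZ a c1 c2) = wregs c1 \<union> wregs c2"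
| "wregs (Loop a c) = {a, rOne} \<union> wregs c"

text \<open>A compiled loop stores 1 in \<open>rOne\<close> to decrement its counter, so the counter
  must be another register.\<close>

primrec wf_cmd :: "cmd \<Rightarrow> bool" where
  "wf_cmd (Blk is) = list_all straight is"
| "wf_cmd (c1 ;; c2) = (wf_cmd c1 \<and> wf_cmd c2)"
| "wf_cmd (IfZ a c1 c2) = (wf_cmd c1 \<and> wf_cmd c2)"
| "wf_cmd (Loop a c) = (a \<noteq> rOne \<and> wf_cmd c)"

text \<open>\<open>Loop a c\<close> decrements register \<open>a\<close> before each execution of \<open>c\<close> and stops when it is 0.\<close>

inductive big :: "cmd \<Rightarrow> store \<Rightarrow> nat \<Rightarrow> store \<Rightarrow> bool" where
  Blk: "big (Blk is) s (length is) (fold effect is s)"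
| Seq: "big c1 s t1 s1 \<Longrightarrow> big c2 s1 t2 s2 \<Longrightarrow> big (c1 ;; c2) s (t1 + t2) s2"
| IfZ0: "R a = 0 \<Longrightarrow> big c1 (R, h) t s \<Longrightarrow> big (IfZ a c1 c2) (R, h) (t + 1) s"
| IfZ1: "R a \<noteq> 0 \<Longrightarrow> big c2 (R, h) t s \<Longrightarrow> big (IfZ a c1 c2) (R, h) (t + 2) s"
| Loop0: "R a = 0 \<Longrightarrow> big (Loop a c) (R, h) 1 (R, h)"
| Loop1: "R a \<noteq> 0 \<Longrightarrow> big c (R(rOne := 1, a := R a - 1), h) t s1 \<Longrightarrow>
    big (Loop a c) s1 t' s2 \<Longrightarrow> big (Loop a c) (R, h) (t + 4 + t') s2"

inductive_cases big_BlkE: "big (Blk is) s t s'"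
inductive_cases big_SeqE: "big (c1 ;; c2) s t s'"
inductive_cases big_IfZE: "big (IfZ a c1 c2) s t s'"

lemma effect_frame: "x \<notin> target i \<Longrightarrow> fst (effect i s) x = fst s x"
  by (cases s; cases i) auto

lemma fold_effect_frame:
  "x \<notin> \<Union> (set (map target is)) \<Longrightarrow> fst (fold effect is s) x = fst s x"
  by (induction "is" arbitrary: s) (auto simp: effect_frame)

lemma big_frame: "big c s t s' \<Longrightarrow> x \<notin> wregs c \<Longrightarrow> fst s' x = fst s x"
proof (induction rule: big.induct)
  case (Blk "is" s)
  then show ?case using fold_effect_frame by simp
qed auto

section \<open>Compilation\<close>

primrec clen :: "cmd \<Rightarrow> nat" where
  "clen (Blk is) = length is"
| "clen (c1 ;; c2) = clen c1 + clen c2"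
| "clen (IfZ a c1 c2) = 2 + clen c2 + clen c1"
| "clen (Loop a c) = 4 + clen c"

text \<open>The layout fixes the costs in \<open>big\<close>: the nonzero branch comes first and is
  left by a jump, so it costs one step more; a loop pass pays for the test, the constant, the
  decrement and the jump back.\<close>

primrec compile :: "cmd \<Rightarrow> nat \<Rightarrow> program" where
  "compile (Blk is) i = is"
| "compile (c1 ;; c2) i = compile c1 i @ compile c2 (i + clen c1)"
| "compile (IfZ a c1 c2) i =
     JumpZero a (i + 2 + clen c2) # compile c2 (i + 1) @
     Jump (i + 2 + clen c2 + clen c1) # compile c1 (i + 2 + clen c2)"
| "compile (Loop a c) i =
     JumpZero a (i + 4 + clen c) # Const rOne 1 # Sub a a rOne # compile c (i + 3) @ [Jump i]"

lemma length_compile [simp]: "length (compile c i) = clen c"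
  by (induction c arbitrary: i) auto

primrec code_at :: "program \<Rightarrow> nat \<Rightarrow> program \<Rightarrow> bool" where
  "code_at P i [] = True"
| "code_at P i (x # xs) = (i < length P \<and> P ! i = x \<and> code_at P (Suc i) xs)"

lemma code_at_append [simp]:
  "code_at P i (xs @ ys) \<longleftrightarrow> code_at P i xs \<and> code_at P (i + length xs) ys"
  by (induction xs arbitrary: i) auto

lemma code_at_infix: "code_at (xs @ ys @ zs) (length xs) ys"
proof (induction ys arbitrary: xs)
  case (Cons y ys)
  from Cons[of "xs @ [y]"] show ?case by simp
qed simp

lemma step_at: "i < length P \<Longrightarrow> step P (Config i R h) = exec (P ! i) (Config i R h)"
  by (simp add: step_def halted_def)

abbreviation at_store :: "nat \<Rightarrow> store \<Rightarrow> config" where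
  "at_store i s \<equiv> Config i (fst s) (snd s)"

lemma run_straight:
  "code_at P i is \<Longrightarrow> list_all straight is \<Longrightarrow>
    (step P ^^ length is) (at_store i s) = at_store (i + length is) (fold effect is s)"
proof (induction "is" arbitrary: i s)
  case (Cons x xs)
  have "step P (at_store i s) = at_store (Suc i) (effect x s)"
    using Cons.prems by (cases s; cases x) (auto simp: step_at)
  with Cons show ?case by (simp add: funpow_swap1 del: funpow.simps) (simp add: funpow_swap1)
qed simp

lemma funpow_add_app: "(f ^^ (m + n)) x = (f ^^ n) ((f ^^ m) x)"
  by (metis add.commute comp_apply funpow_add)

text \<open>Induction on the derivation. The time in \<open>big\<close> is the exact number of
  machine steps, so runs compose by adding the exponents of \<open>step P\<close>.\<close>

lemma compile_correct:
  "big c s t s' \<Longrightarrow> wf_cmd c \<Longrightarrow> code_at P i (compile c i) \<Longrightarrow>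
    (step P ^^ t) (at_store i s) = at_store (i + clen c) s'"
proof (induction arbitrary: i rule: big.induct)
  case (Blk "is" s)
  then show ?case using run_straight by simp
next
  case (Seq c1 s t1 s1 c2 t2 s2)
  then show ?case by (simp add: funpow_add_app add.assoc)
next
  case (IfZ0 R a c1 h t s c2)
  have *: "(step P ^^ (t + 1)) x = (step P ^^ t) (step P x)" for x by (simp add: funpow_swap1)
  have "step P (at_store i (R, h)) = at_store (i + 2 + clen c2) (R, h)"
    using IfZ0 by (simp add: step_at)
  with IfZ0 show ?case unfolding * by (simp add: ac_simps numeral_2_eq_2)
next
  case (IfZ1 R a c2 h t s c1)
  have *: "(step P ^^ (t + 2)) x = step P ((step P ^^ t) (step P x))" for x
    by (simp add: funpow_swap1 numeral_2_eq_2)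
  have "step P (at_store i (R, h)) = at_store (i + 1) (R, h)"
    using IfZ1 by (simp add: step_at)
  moreover have "(step P ^^ t) (at_store (i + 1) (R, h)) = at_store (i + 1 + clen c2) s"
    using IfZ1 by simp
  ultimately show ?case using IfZ1.prems unfolding * by (simp add: ac_simps step_at)
next
  case (Loop0 R a c h)
  then show ?case by (simp add: step_at)
next
  case (Loop1 R a c h t s1 t' s2)
  have *: "(step P ^^ (t + 4 + t')) x
     = (step P ^^ t') (step P ((step P ^^ t) (step P (step P (step P x)))))" for x
    by (simp add: funpow_add_app numeral_eq_Suc funpow_swap1)
  define s0 where "s0 = (R(rOne := 1, a := R a - 1), h)"
  have c: "code_at P (i + 3) (compile c (i + 3))" "i < length P" "i + 1 < length P" "i + 2 < length P"
    "i + 3 + clen c < length P" "P ! i = JumpZero a (i + 4 + clen c)" "P ! (i + 1) = Const rOne 1"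
    "P ! (i + 2) = Sub a a rOne" "P ! (i + 3 + clen c) = Jump i"
    using Loop1.prems(2) by (simp_all add: numeral_eq_Suc)
  have "step P (step P (step P (at_store i (R, h)))) = at_store (i + 3) s0"
    using Loop1.hyps(1) Loop1.prems(1) c by (simp add: step_at s0_def numeral_eq_Suc)
  moreover have "(step P ^^ t) (at_store (i + 3) s0) = at_store (i + 3 + clen c) s1"
    unfolding s0_def by (rule Loop1.IH(1)) (use Loop1.prems(1) c(1) in simp_all)
  moreover have "step P (at_store (i + 3 + clen c) s1) = at_store i s1"
    using c by (simp add: step_at)
  moreover have "(step P ^^ t') (at_store i s1) = at_store (i + clen (Loop a c)) s2"
    using Loop1.IH(2) Loop1.prems by blast
  ultimately show ?case unfolding * by simp
qed

section \<open>Weakest preconditions\<close>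

definition wp :: "cmd \<Rightarrow> ((nat \<Rightarrow> nat) \<Rightarrow> (nat \<Rightarrow> nat) \<Rightarrow> nat \<Rightarrow> bool) \<Rightarrow>
    (nat \<Rightarrow> nat) \<Rightarrow> (nat \<Rightarrow> nat) \<Rightarrow> bool" where
  "wp c Q R h \<longleftrightarrow> (\<exists>t R' h'. big c (R, h) t (R', h') \<and> Q R' h' t)"

lemma wp_Blk [simp]:
  "wp (Blk is) Q R h \<longleftrightarrow> (case fold effect is (R, h) of (R', h') \<Rightarrow> Q R' h' (length is))"
  unfolding wp_def by (auto intro: big.Blk elim!: big_BlkE split: prod.splits) (metis big.Blk)

lemma wp_Seq [simp]:
  "wp (c1 ;; c2) Q R h \<longleftrightarrow> wp c1 (\<lambda>R1 h1 t1. wp c2 (\<lambda>R2 h2 t2. Q R2 h2 (t1 + t2)) R1 h1) R h"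
  unfolding wp_def by (fastforce intro: big.Seq elim!: big_SeqE)

lemma wp_IfZ [simp]:
  "wp (IfZ a c1 c2) Q R h \<longleftrightarrow>
     (if R a = 0 then wp c1 (\<lambda>R h t. Q R h (t + 1)) R h else wp c2 (\<lambda>R h t. Q R h (t + 2)) R h)"
proof -
  have "big (IfZ a c1 c2) (R, h) t s \<longleftrightarrow> (\<exists>t'. t = t' + 1 \<and> big c1 (R, h) t' s)" if "R a = 0" for t s
    using that by (auto elim: big_IfZE dest: big.IfZ0)
  moreover have "big (IfZ a c1 c2) (R, h) t s \<longleftrightarrow> (\<exists>t'. t = t' + 2 \<and> big c2 (R, h) t' s)" if "R a \<noteq> 0" for t s
    using that big.IfZ1[of R a c2 h _ s c1] by (auto elim: big_IfZE)
  ultimately show ?thesis unfolding wp_def by auto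
qed

lemma wp_Loop:
  assumes "R a = N" "I N R h" "a \<notin> wregs c" "a \<noteq> rOne"
    and step: "\<And>n R1 h1. n < N \<Longrightarrow> I (Suc n) R1 h1 \<Longrightarrow> \<forall>x. x \<notin> wregs (Loop a c) \<longrightarrow> R1 x = R x \<Longrightarrow>
       R1 a = Suc n \<Longrightarrow>
       wp c (\<lambda>R2 h2 t. I n R2 h2 \<and> t \<le> T) (R1(rOne := 1, a := n)) h1"
    and post: "\<And>R' h' t. I 0 R' h' \<Longrightarrow> \<forall>x. x \<notin> wregs (Loop a c) \<longrightarrow> R' x = R x \<Longrightarrow>
       t \<le> 1 + N * (T + 4) \<Longrightarrow> Q R' h' t"
  shows "wp (Loop a c) Q R h"
proof -
  have "\<exists>t R' h'. big (Loop a c) (R1, h1) t (R', h') \<and> I 0 R' h' \<and> t \<le> 1 + n * (T + 4)"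
    if "n \<le> N" "I n R1 h1" "\<forall>x. x \<notin> wregs (Loop a c) \<longrightarrow> R1 x = R x" "R1 a = n" for n R1 h1
    using that
  proof (induction n arbitrary: R1 h1)
    case 0
    then show ?case using big.Loop0[of R1 a c h1] by force
  next
    case (Suc n)
    let ?R = "R1(rOne := 1, a := n)"
    from step[of n R1 h1] Suc.prems obtain t R2 h2
      where b: "big c (?R, h1) t (R2, h2)" and I: "I n R2 h2" and t: "t \<le> T"
      unfolding wp_def by (auto simp: Suc_le_eq)
    have f: "R2 x = ?R x" if "x \<notin> wregs c" for x using big_frame[OF b that] by simp
    have "\<forall>x. x \<notin> wregs (Loop a c) \<longrightarrow> R2 x = R x" using f Suc.prems(3) by auto
    moreover have "R2 a = n" using f assms(3,4) by simp
    ultimately obtain t' R' h' where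
      "big (Loop a c) (R2, h2) t' (R', h')" "I 0 R' h'" "t' \<le> 1 + n * (T + 4)"
      using Suc.IH[of R2 h2] I Suc.prems by auto
    moreover from this b have "big (Loop a c) (R1, h1) (t + 4 + t') (R', h')"
      using big.Loop1[of R1 a c h1 t "(R2, h2)" t' "(R', h')"] Suc.prems by simp
    ultimately show ?case using t by (intro exI conjI) auto
  qed
  from this[of N R h] assms(1,2) obtain t R' h'
    where b: "big (Loop a c) (R, h) t (R', h')" and "I 0 R' h'" "t \<le> 1 + N * (T + 4)" by auto
  then show ?thesis
    using post[of R' h' t] big_frame[OF b] unfolding wp_def by (metis fst_conv)
qed

text \<open>Registers that \<open>c\<close> does not write are still 0 at the end, which gives the
  appended program \<open>P\<close> a clean start.\<close>

lemma wp_run: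
  assumes "wp c Q (\<lambda>_. 0) (mem (initial w))" "wf_cmd c"
  obtains t R h where "(step (compile c 0 @ P) ^^ t) (initial w) = Config (clen c) R h" "Q R h t"
    "\<forall>x. x \<notin> wregs c \<longrightarrow> R x = 0"
proof -
  from assms(1) obtain t R h where b: "big c (\<lambda>_. 0, mem (initial w)) t (R, h)" and Q: "Q R h t"
    unfolding wp_def by blast
  have "code_at (compile c 0 @ P) 0 (compile c 0)"
    using code_at_infix[of "[]" "compile c 0" P] by simp
  from compile_correct[OF b assms(2) this] have
    "(step (compile c 0 @ P) ^^ t) (initial w) = Config (clen c) R h"
    by (simp add: initial_def)
  with Q that big_frame[OF b] show ?thesis by (metis fst_conv)
qed

section \<open>Relocated programs\<close>

text \<open>Every instruction becomes exactly two, so that instruction \<open>l\<close> of a relocated program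
  always starts at \<open>s + 2 * l\<close>.\<close>

definition ren :: "nat \<Rightarrow> nat" where "ren x = (if x = 0 then 0 else x + 30)"

fun reloc :: "nat \<Rightarrow> instr \<Rightarrow> instr list" where
  "reloc s (Const d c) = [Const rTmp 0, Const (ren d) c]"
| "reloc s (Add d a b) = [Const rTmp 0, Add (ren d) (ren a) (ren b)]"
| "reloc s (Sub d a b) = [Const rTmp 0, Sub (ren d) (ren a) (ren b)]"
| "reloc s (Half d a) = [Const rTmp 0, Half (ren d) (ren a)]"
| "reloc s (Read d a) = [Add rTmp (ren a) rOff, Read (ren d) rTmp]"
| "reloc s (Write a b) = [Add rTmp (ren a) rOff, Write rTmp (ren b)]"
| "reloc s (Jump l) = [Const rTmp 0, Jump (s + 2 * l)]"
| "reloc s (JumpZero a l) = [Const rTmp 0, JumpZero (ren a) (s + 2 * l)]"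

text \<open>Register 0 keeps its number under \<open>ren\<close> because it holds the answer. Cells
  below \<open>off\<close> are unconstrained, as they belong to the input of the reduction.\<close>

fun related :: "nat \<Rightarrow> nat \<Rightarrow> config \<Rightarrow> config \<Rightarrow> bool" where
  "related s off (Config i R h) (Config i' R' h') \<longleftrightarrow>
     i' = s + 2 * i \<and> (\<forall>x. R' (ren x) = R x) \<and> R' rOff = off \<and> (\<forall>a. h' (off + a) = h a)"

lemma ren_simps [simp]: "ren x = ren y \<longleftrightarrow> x = y" "ren x \<noteq> 4" "ren x \<noteq> 5" "4 \<noteq> ren x" "5 \<noteq> ren x"
  by (auto simp: ren_def)

lemma length_reloc [simp]: "length (reloc s i) = 2"
  by (cases i) auto

lemma nth_concat_reloc:
  "j < length P \<Longrightarrow> concat (map (reloc s) P) ! (2 * j) = reloc s (P ! j) ! 0 \<and>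
     concat (map (reloc s) P) ! Suc (2 * j) = reloc s (P ! j) ! 1"
proof (induction P arbitrary: j)
  case (Cons i P)
  then show ?case by (cases j) (auto simp: nth_append)
qed simp

lemma length_concat_reloc [simp]: "length (concat (map (reloc s) P)) = 2 * length P"
  by (induction P) auto

text \<open>Two steps simulate one. Halted configurations are fixed points of \<open>step\<close> on
  both sides, so the relation survives halting and can be iterated freely.\<close>

lemma reloc_step:
  assumes "s = length pre" and Pr: "Pr = pre @ concat (map (reloc s) P)"
    and "related s off x y"
  shows "related s off (step P x) (step Pr (step Pr y))"
proof -
  obtain i R h where x: "x = Config i R h" by (cases x)
  obtain i' R' h' where y: "y = Config i' R' h'" by (cases y)
  have rel: "i' = s + 2 * i" "\<And>x. R' (ren x) = R x" "R' rOff = off" "\<And>a. h' (off + a) = h a"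
    using assms(3) x y by auto
  have off: "h' (a + off) = h a" for a using rel(4)[of a] by (simp add: add.commute)
  show ?thesis
  proof (cases "i < length P")
    case False
    then show ?thesis using assms x y by (simp add: step_def halted_def)
  next
    case True
    have l: "i' < length Pr" "Suc i' < length Pr" using True assms rel by auto
    have n: "Pr ! i' = reloc s (P ! i) ! 0" "Pr ! Suc i' = reloc s (P ! i) ! 1"
      using nth_concat_reloc[OF True, of s] assms(1) rel(1) unfolding Pr
      by (simp_all add: nth_append)
    have sx: "step P x = exec (P ! i) x" using True x by (simp add: step_at)
    show ?thesis unfolding sx unfolding x y
      using rel n by (cases "P ! i") (auto simp: step_at l[unfolded rel(1)] off)
  qed
qed

lemma reloc_run:
  assumes "s = length pre" and "Pr = pre @ concat (map (reloc s) P)"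
    and "related s off x y"
  shows "related s off ((step P ^^ t) x) ((step Pr ^^ (2 * t)) y)"
proof (induction t)
  case (Suc t)
  from reloc_step[OF assms(1,2) this] show ?case by simp
qed (use assms in simp)

lemma reloc_halted:
  assumes "s = length pre" and "Pr = pre @ concat (map (reloc s) P)" and "related s off x y"
  shows "halted Pr y \<longleftrightarrow> halted P x" "accepting y \<longleftrightarrow> accepting x"
proof -
  show "halted Pr y \<longleftrightarrow> halted P x" using assms by (cases x; cases y) (auto simp: halted_def)
  have "regs y (ren 0) = regs x 0" using assms(3) by (cases x; cases y) auto
  then show "accepting y \<longleftrightarrow> accepting x" by (simp add: accepting_def ren_def)
qed

section \<open>Reducing satisfiability to distinct vectors\<close>

text \<open>\<open>submatrix\<close> renumbers the chosen columns by \<open>pick K\<close>. As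
  \<open>pick K\<close> enumerates \<open>K\<close>, comparing rows of the submatrix means comparing
  entries in the original columns.\<close>

lemma distinct_rows_submatrix:
  assumes "K \<subseteq> {..<dim_col A}"
  shows "distinct (rows (submatrix A UNIV K)) \<longleftrightarrow>
    (\<forall>i<dim_row A. \<forall>i'<dim_row A. i \<noteq> i' \<longrightarrow> (\<exists>j\<in>K. A $$ (i, j) \<noteq> A $$ (i', j)))"
proof -
  let ?S = "submatrix A UNIV K"
  have K: "{j. j < dim_col A \<and> j \<in> K} = K" using assms by auto
  have dims: "dim_row ?S = dim_row A" "dim_col ?S = card K"
    by (simp_all add: dim_submatrix K)
  have entry: "?S $$ (i, j) = A $$ (i, pick K j)" if "i < dim_row A" "j < card K" for i j
    using that by (subst submatrix_index) (simp_all add: K pick_UNIV)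
  have fin: "finite K" using assms finite_subset by blast
  have "row ?S i = row ?S i' \<longleftrightarrow> (\<forall>j\<in>K. A $$ (i, j) = A $$ (i', j))"
    if i: "i < dim_row A" "i' < dim_row A" for i i'
  proof -
    have "row ?S i = row ?S i' \<longleftrightarrow> (\<forall>j<card K. A $$ (i, pick K j) = A $$ (i', pick K j))"
      using i by (auto simp: vec_eq_iff dims entry)
    also have "\<dots> \<longleftrightarrow> (\<forall>j\<in>K. A $$ (i, j) = A $$ (i', j))"
    proof (intro iffI ballI allI impI)
      fix j assume *: "\<forall>j<card K. A $$ (i, pick K j) = A $$ (i', pick K j)" and j: "j \<in> K"
      \<comment> \<open>The number of smaller elements of \<open>K\<close> is the index at which
        \<open>pick K\<close> yields \<open>j\<close>.\<close>
      have "{a\<in>K. a < j} \<subset> K" using j by auto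
      then have "card {a\<in>K. a < j} < card K" using fin psubset_card_mono by blast
      with * have "A $$ (i, pick K (card {a\<in>K. a < j})) = A $$ (i', pick K (card {a\<in>K. a < j}))" by blast
      then show "A $$ (i, j) = A $$ (i', j)" by (simp only: pick_card_in_set[OF j])
    qed (simp add: pick_in_set_le)
    finally show ?thesis .
  qed
  then show ?thesis
    by (auto simp: distinct_conv_nth rows_def dims)
qed

text \<open>Allows naming rows and columns by identifiers. As both lists are free of repetitions,
  indexing is injective and preserves \<open>card K\<close> and the inequality of rows.\<close>

lemma distinct_vectors_tabulated:
  assumes "distinct Rs" "distinct Cs"
  shows "distinct_vectors (mat (length Rs) (length Cs) (\<lambda>(i, j). V (Rs ! i) (Cs ! j)), k) \<longleftrightarrow>
    (\<exists>K \<subseteq> set Cs. card K \<le> k \<and>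
      (\<forall>x\<in>set Rs. \<forall>y\<in>set Rs. x \<noteq> y \<longrightarrow> (\<exists>c\<in>K. V x c \<noteq> V y c)))"
    (is "?L \<longleftrightarrow> (\<exists>K \<subseteq> set Cs. ?good K)")
proof -
  let ?A = "mat (length Rs) (length Cs) (\<lambda>(i, j). V (Rs ! i) (Cs ! j))"
  let ?n = "length Cs"
  have sep: "distinct (rows (submatrix ?A UNIV K)) \<longleftrightarrow>
      (\<forall>x\<in>set Rs. \<forall>y\<in>set Rs. x \<noteq> y \<longrightarrow> (\<exists>c\<in>(!) Cs ` K. V x c \<noteq> V y c))" if "K \<subseteq> {..<?n}" for K
  proof -
    have "distinct (rows (submatrix ?A UNIV K)) \<longleftrightarrow>
      (\<forall>i<length Rs. \<forall>i'<length Rs. i \<noteq> i' \<longrightarrow> (\<exists>j\<in>K. ?A $$ (i, j) \<noteq> ?A $$ (i', j)))"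
      using that by (subst distinct_rows_submatrix) auto
    also have "\<dots> \<longleftrightarrow> (\<forall>i<length Rs. \<forall>i'<length Rs. Rs ! i \<noteq> Rs ! i' \<longrightarrow>
        (\<exists>j\<in>K. V (Rs ! i) (Cs ! j) \<noteq> V (Rs ! i') (Cs ! j)))"
    proof -
      have "(\<exists>j\<in>K. ?A $$ (i, j) \<noteq> ?A $$ (i', j)) \<longleftrightarrow>
          (\<exists>j\<in>K. V (Rs ! i) (Cs ! j) \<noteq> V (Rs ! i') (Cs ! j))"
        if "i < length Rs" "i' < length Rs" for i i'
        using that \<open>K \<subseteq> {..<?n}\<close> by (intro bex_cong) auto
      then show ?thesis by (simp add: nth_eq_iff_index_eq[OF assms(1)])
    qed
    also have "\<dots> \<longleftrightarrow> (\<forall>x\<in>set Rs. \<forall>y\<in>set Rs. x \<noteq> y \<longrightarrow> (\<exists>c\<in>(!) Cs ` K. V x c \<noteq> V y c))"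
      by (simp add: all_set_conv_all_nth)
    finally show ?thesis .
  qed
  have card: "card ((!) Cs ` K) = card K" if "K \<subseteq> {..<?n}" for K
    using that assms(2) by (intro card_image inj_on_nth) auto
  have set: "set Cs = (!) Cs ` {..<?n}" by (auto simp: in_set_conv_nth)
  have iff: "card K \<le> k \<and> distinct (rows (submatrix ?A UNIV K)) \<longleftrightarrow> ?good ((!) Cs ` K)" if "K \<subseteq> {..<?n}" for K
    by (simp only: sep[OF that] card[OF that])
  have "?L \<longleftrightarrow> (\<exists>K \<subseteq> {..<?n}. card K \<le> k \<and> distinct (rows (submatrix ?A UNIV K)))"
    by (simp only: distinct_vectors_def prod.case dim_col_mat)
  also have "\<dots> \<longleftrightarrow> (\<exists>K \<subseteq> {..<?n}. ?good ((!) Cs ` K))"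
    using iff by blast
  also have "\<dots> \<longleftrightarrow> (\<exists>K \<subseteq> set Cs. ?good K)"
  proof
    assume "\<exists>K \<subseteq> set Cs. ?good K"
    then obtain K where "K \<subseteq> (!) Cs ` {..<?n}" "?good K" unfolding set by blast
    then show "\<exists>K \<subseteq> {..<?n}. ?good ((!) Cs ` K)" by (elim subset_imageE) blast
  next
    assume "\<exists>K \<subseteq> {..<?n}. ?good ((!) Cs ` K)"
    then obtain K where "K \<subseteq> {..<?n}" "?good ((!) Cs ` K)" by blast
    then show "\<exists>K \<subseteq> set Cs. ?good K"
      by (intro exI[of _ "(!) Cs ` K"] conjI) (auto simp: set)
  qed
  finally show ?thesis .
qed

text \<open>Variable \<open>v\<close> belongs to group \<open>v mod g\<close>; an assignment of group \<open>i\<close> is the number \<open>a\<close> whose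
  bit \<open>v div g\<close> is the value of \<open>v\<close>.\<close>

definition lit_holds :: "nat \<Rightarrow> nat \<Rightarrow> nat \<Rightarrow> literal \<Rightarrow> bool" where
  "lit_holds g i a = (\<lambda>(v, b). v mod g = i \<and> odd (a div 2 ^ (v div g)) = b)"

text \<open>The tags \<open>t \<ge> length \<phi>\<close> act as clauses satisfied by every assignment of a single group,
  which forces an assignment to be selected for that group.\<close>

definition sat :: "nat \<Rightarrow> cnf \<Rightarrow> nat \<Rightarrow> nat \<Rightarrow> nat \<Rightarrow> bool" where
  "sat g \<phi> t i a \<longleftrightarrow>
     (if t < length \<phi> then \<exists>l\<in>set (\<phi> ! t). lit_holds g i a l else (t - length \<phi>) mod g = i)"

type_synonym row_id = "nat \<times> bool"
type_synonym col_id = "nat + nat \<times> nat"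

text \<open>Column \<open>Inl j\<close> is the \<open>j\<close>-th tag bit, column \<open>Inr (i, a)\<close> stands for assignment \<open>a\<close> of
  group \<open>i\<close>.\<close>

fun entry :: "nat \<Rightarrow> cnf \<Rightarrow> row_id \<Rightarrow> col_id \<Rightarrow> bool" where
  "entry g \<phi> (t, b) (Inl j) = odd (t div 2 ^ j)"
| "entry g \<phi> (t, b) (Inr (i, a)) = (b \<and> sat g \<phi> t i a)"

text \<open>This order, like the reversed lists in \<open>col_ids\<close>, is the one in which the
  program below writes the entries; its loops count down.\<close>

definition row_ids :: "nat \<Rightarrow> row_id list" where
  "row_ids H = concat (map (\<lambda>t. [(t, True), (t, False)]) [0..<H])"

definition col_ids :: "nat \<Rightarrow> nat \<Rightarrow> nat \<Rightarrow> col_id list" where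
  "col_ids g h S = map Inl [0..<h] @
     concat (map (\<lambda>i. map (\<lambda>a. Inr (i, a)) (rev [0..<S])) (rev [0..<g]))"

definition dv_matrix :: "nat \<Rightarrow> nat \<Rightarrow> nat \<Rightarrow> nat \<Rightarrow> cnf \<Rightarrow> bool mat" where
  "dv_matrix g h H S \<phi> = mat (length (row_ids H)) (length (col_ids g h S))
     (\<lambda>(i, j). entry g \<phi> (row_ids H ! i) (col_ids g h S ! j))"

lemma set_row_ids: "set (row_ids H) = {..<H} \<times> UNIV"
  by (auto simp: row_ids_def)

lemma set_col_ids: "set (col_ids g h S) = Inl ` {..<h} \<union> Inr ` ({..<g} \<times> {..<S})"
  by (auto simp: col_ids_def)

lemma length_row_ids [simp]: "length (row_ids H) = 2 * H"
  by (induction H) (auto simp: row_ids_def)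

lemma length_col_ids [simp]: "length (col_ids g h S) = h + g * S"
proof -
  have "length (concat (map (\<lambda>i. map (\<lambda>a. Inr (i, a) :: col_id) (rev [0..<S])) xs)) = length xs * S" for xs
    by (induction xs) auto
  then show ?thesis by (simp add: col_ids_def)
qed

lemma distinct_row_ids: "distinct (row_ids H)"
  by (rule card_distinct) (simp add: set_row_ids card_cartesian_product)

lemma distinct_col_ids: "distinct (col_ids g h S)"
proof (rule card_distinct)
  have "card (Inl ` {..<h} \<union> Inr ` ({..<g} \<times> {..<S}) :: col_id set)
      = card (Inl ` {..<h} :: col_id set) + card (Inr ` ({..<g} \<times> {..<S}) :: col_id set)"
    by (intro card_Un_disjoint) auto
  then show "card (set (col_ids g h S)) = length (col_ids g h S)"
    by (simp add: set_col_ids card_image card_cartesian_product)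
qed

section \<open>Correctness of the construction\<close>

lemma ex_num_of_bits: "\<exists>a::nat. a < 2 ^ B \<and> (\<forall>x<B. odd (a div 2 ^ x) = \<beta> x)" for \<beta> :: "nat \<Rightarrow> bool"
proof (induction B arbitrary: \<beta>)
  case (Suc B)
  from Suc[of "\<beta> \<circ> Suc"] obtain a :: nat
    where a: "a < 2 ^ B" "\<forall>x<B. odd (a div 2 ^ x) = \<beta> (Suc x)" by auto
  have "odd ((2 * a + of_bool (\<beta> 0)) div 2 ^ x) = \<beta> x" if "x < Suc B" for x
    using that a(2) by (cases x) (auto simp: div_mult2_eq)
  moreover have "2 * a + of_bool (\<beta> 0) < 2 ^ Suc B" using a(1) by auto
  ultimately show ?case by blast
qed simp

text \<open>Makes the tag columns separate rows with different tags.\<close>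

lemma ex_differing_bit:
  fixes t t' :: nat
  assumes "t < 2 ^ h" "t' < 2 ^ h" "t \<noteq> t'"
  shows "\<exists>j<h. odd (t div 2 ^ j) \<noteq> odd (t' div 2 ^ j)"
  using assms
proof (induction h arbitrary: t t')
  case (Suc h)
  show ?case
  proof (cases "odd t = odd t'")
    case True
    then have "t div 2 \<noteq> t' div 2" using Suc.prems(3) by presburger
    moreover have "t div 2 < 2 ^ h" "t' div 2 < 2 ^ h"
      using Suc.prems by (simp_all add: less_mult_imp_div_less)
    ultimately obtain j
      where "j < h" "odd (t div 2 div 2 ^ j) \<noteq> odd (t' div 2 div 2 ^ j)"
      using Suc.IH by blast
    then show ?thesis by (intro exI[of _ "Suc j"]) (simp add: div_mult2_eq)
  next
    case False
    then show ?thesis by (intro exI[of _ 0]) simp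
  qed
qed simp

lemma odd_power_div_iff: "odd ((2 :: nat) ^ j div 2 ^ i) \<longleftrightarrow> i = j"
  by (auto simp: exp_div_exp_eq)

lemma distinct_vectors_dv_matrix:
  "distinct_vectors (dv_matrix g h H S \<phi>, k) \<longleftrightarrow>
    (\<exists>K \<subseteq> set (col_ids g h S). card K \<le> k \<and>
      (\<forall>x\<in>{..<H} \<times> UNIV. \<forall>y\<in>{..<H} \<times> UNIV. x \<noteq> y \<longrightarrow>
        (\<exists>c\<in>K. entry g \<phi> x c \<noteq> entry g \<phi> y c)))"
  unfolding dv_matrix_def distinct_vectors_tabulated[OF distinct_row_ids distinct_col_ids] set_row_ids
  by (rule refl)

text \<open>The solution takes all tag columns and, for each group, the column of a satisfying
  assignment restricted to it. Rows with equal tags differ at the group of a true literal, or at the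
  group named by a filler tag. \<open>r \<le> g * B\<close> ensures that \<open>B\<close> bits per
  group reach every variable.\<close>

lemma distinct_vectors_if_satisfiable:
  assumes \<phi>: "is_3cnf r \<phi>" and g: "g > 0" and B: "r \<le> g * B" and sat: "satisfiable \<phi>"
  shows "distinct_vectors (dv_matrix g h (2 ^ h) (2 ^ B) \<phi>, g + h)"
proof -
  obtain \<alpha> where \<alpha>: "\<forall>cl\<in>set \<phi>. \<exists>(v, b)\<in>set cl. \<alpha> v = b"
    using sat unfolding satisfiable_def by blast
  \<comment> \<open>For \<open>i < g\<close>, variable \<open>g * x + i\<close> has position
    \<open>x\<close> in group \<open>i\<close>, so \<open>f i\<close> will be the number of \<alpha>
    on that group.\<close>
  have "\<forall>i. \<exists>a::nat. a < 2 ^ B \<and> (\<forall>x<B. odd (a div 2 ^ x) = \<alpha> (g * x + i))"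
    by (intro allI ex_num_of_bits)
  from choice[OF this] obtain f :: "nat \<Rightarrow> nat"
    where f: "\<And>i. f i < 2 ^ B" "\<And>i x. x < B \<Longrightarrow> odd (f i div 2 ^ x) = \<alpha> (g * x + i)"
    by blast
  define K :: "col_id set" where "K = Inl ` {..<h} \<union> (\<lambda>i. Inr (i, f i)) ` {..<g}"
  have "\<exists>c\<in>K. entry g \<phi> x c \<noteq> entry g \<phi> y c"
    if "x \<in> {..<2 ^ h} \<times> UNIV" "y \<in> {..<2 ^ h} \<times> UNIV" "x \<noteq> y" for x y
  proof -
    obtain t b t' b' where xy: "x = (t, b)" "y = (t', b')" by fastforce
    show ?thesis
    proof (cases "t = t'")
      case False
      with ex_differing_bit[of t h t'] that xy obtain j
        where "j < h" "odd (t div 2 ^ j) \<noteq> odd (t' div 2 ^ j)" by auto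
      then show ?thesis unfolding xy K_def by (intro bexI[of _ "Inl j"]) auto
    next
      case True
      have "\<exists>i<g. sat g \<phi> t i (f i)"
      proof (cases "t < length \<phi>")
        case t: True
        then have cl: "\<phi> ! t \<in> set \<phi>" by simp
        with \<alpha> obtain v b where l: "(v, b) \<in> set (\<phi> ! t)" "\<alpha> v = b" by blast
        with cl \<phi> have "v < r" unfolding is_3cnf_def by blast
        then have "v < B * g" using B by (simp add: mult.commute)
        then have "v div g < B" by (rule less_mult_imp_div_less)
        from f(2)[OF this, of "v mod g"] l have "lit_holds g (v mod g) (f (v mod g)) (v, b)"
          by (simp add: lit_holds_def)
        with l t g show ?thesis by (intro exI[of _ "v mod g"]) (auto simp: sat_def)
      next
        case False
        with g show ?thesis by (intro exI[of _ "(t - length \<phi>) mod g"]) (auto simp: sat_def)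
      qed
      then obtain i where i: "i < g" "sat g \<phi> t i (f i)" by blast
      moreover have "b \<noteq> b'" using True that(3) xy by simp
      ultimately show ?thesis unfolding xy K_def True[symmetric]
        by (intro bexI[of _ "Inr (i, f i)"]) auto
    qed
  qed
  moreover have "K \<subseteq> set (col_ids g h (2 ^ B))" using f(1) by (auto simp: K_def set_col_ids)
  moreover have "card K \<le> g + h"
  proof -
    have "card K \<le> card (Inl ` {..<h} :: col_id set) + card ((\<lambda>i. Inr (i, f i) :: col_id) ` {..<g})"
      unfolding K_def by (rule card_Un_le)
    also have "\<dots> \<le> h + g" by (intro add_mono) (metis card_image_le card_lessThan finite_lessThan)+
    finally show ?thesis by simp
  qed
  ultimately show ?thesis
    unfolding distinct_vectors_dv_matrix by (intro exI[of _ K] conjI ballI impI) simp_all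
qed

text \<open>\<open>H\<close> leaves a filler tag for every group, so each group needs a column
  besides the \<open>h\<close> forced tag columns. The budget \<open>g + h\<close> then has no room
  for a second assignment of any group.\<close>

lemma satisfiable_if_distinct_vectors:
  assumes H: "length \<phi> + g \<le> 2 ^ h" and "distinct_vectors (dv_matrix g h (2 ^ h) S \<phi>, g + h)"
  shows "satisfiable \<phi>"
proof -
  obtain K where K: "K \<subseteq> set (col_ids g h S)" "card K \<le> g + h"
    and sepK: "\<forall>x\<in>{..<2 ^ h} \<times> UNIV. \<forall>y\<in>{..<2 ^ h} \<times> UNIV. x \<noteq> y \<longrightarrow>
      (\<exists>c\<in>K. entry g \<phi> x c \<noteq> entry g \<phi> y c)"
    using iffD1[OF distinct_vectors_dv_matrix assms(2)] by (elim exE conjE)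
  have sep: "\<exists>c\<in>K. entry g \<phi> x c \<noteq> entry g \<phi> y c"
    if "x \<in> {..<2 ^ h} \<times> UNIV" "y \<in> {..<2 ^ h} \<times> UNIV" "x \<noteq> y" for x y
    using bspec[OF bspec[OF sepK that(1)] that(2)] that(3) by (rule mp)
  \<comment> \<open>The 0-rows of the tags 0 and \<open>2 ^ j\<close> differ only in tag column
    \<open>j\<close>.\<close>
  have helper: "Inl j \<in> K" if j: "j < h" for j
  proof -
    obtain c where c: "c \<in> K" "entry g \<phi> (0, False) c \<noteq> entry g \<phi> (2 ^ j, False) c"
      using sep[of "(0, False)" "(2 ^ j, False)"] j by auto
    then have "c = Inl j"
      by (cases "(g, \<phi>, (0 :: nat, False), c)" rule: entry.cases) (auto simp: odd_power_div_iff)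
    with c show ?thesis by simp
  qed
  have pair: "\<exists>i a. Inr (i, a) \<in> K \<and> sat g \<phi> t i a" if t: "t < 2 ^ h" for t
  proof -
    obtain c where c: "c \<in> K" "entry g \<phi> (t, False) c \<noteq> entry g \<phi> (t, True) c"
      using sep[of "(t, False)" "(t, True)"] t by auto
    then show ?thesis by (cases c) auto
  qed
  \<comment> \<open>\<open>length \<phi> + i\<close> is a filler tag, marked only at group
    \<open>i\<close>.\<close>
  have "\<exists>a. Inr (i, a) \<in> K" if "i < g" for i
    using pair[of "length \<phi> + i"] that H by (auto simp: sat_def)
  then obtain f where f: "\<And>i. i < g \<Longrightarrow> Inr (i, f i) \<in> K" by metis
  define F :: "col_id set" where "F = Inl ` {..<h} \<union> (\<lambda>i. Inr (i, f i)) ` {..<g}"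
  \<comment> \<open>\<open>F\<close> lies in \<open>K\<close> and already exhausts the
    budget.\<close>
  have "F = K"
  proof (rule card_seteq)
    show "finite K" using K(1) finite_subset by blast
    show "F \<subseteq> K" using helper f by (auto simp: F_def)
    have "card F = card (Inl ` {..<h} :: col_id set) + card ((\<lambda>i. Inr (i, f i) :: col_id) ` {..<g})"
      unfolding F_def by (intro card_Un_disjoint) auto
    then have "card F = h + g" by (simp add: card_image inj_on_def)
    with K(2) show "card K \<le> card F" by simp
  qed
  then have uniq: "a = f i" if "Inr (i, a) \<in> K" for i a using that by (auto simp: F_def)
  define \<alpha> where "\<alpha> v = odd (f (v mod g) div 2 ^ (v div g))" for v
  have "\<exists>(v, b)\<in>set cl. \<alpha> v = b" if cl: "cl \<in> set \<phi>" for cl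
  proof -
    from cl obtain t where t: "t < length \<phi>" "\<phi> ! t = cl" by (metis in_set_conv_nth)
    with pair[of t] H obtain i a where "Inr (i, a) \<in> K" "sat g \<phi> t i a" by auto
    then obtain v b where "(v, b) \<in> set cl" "lit_holds g i (f i) (v, b)"
      using t uniq by (auto simp: sat_def)
    then show ?thesis by (auto simp: lit_holds_def \<alpha>_def)
  qed
  then show ?thesis unfolding satisfiable_def by blast
qed

lemma encode_dv_matrix:
  "encode_dv (dv_matrix g h H S \<phi>, k) = k # (2 * H) # (h + g * S) #
     concat (map (\<lambda>x. map (\<lambda>c. of_bool (entry g \<phi> x c)) (col_ids g h S)) (row_ids H))"
proof -
  let ?R = "row_ids H" and ?C = "col_ids g h S"
  have m: "map (\<lambda>i. F (xs ! i)) [0..<length xs] = map F xs" for F :: "'x \<Rightarrow> 'y" and xs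
    by (rule nth_equalityI) auto
  have "map (\<lambda>i. map (\<lambda>j. of_bool (dv_matrix g h H S \<phi> $$ (i, j)) :: nat) [0..<length ?C]) [0..<length ?R]
     = map (\<lambda>i. map (\<lambda>j. of_bool (entry g \<phi> (?R ! i) (?C ! j))) [0..<length ?C]) [0..<length ?R]"
    by (intro map_cong refl) (simp add: dv_matrix_def del: length_row_ids length_col_ids)
  also have "\<dots> = map (\<lambda>x. map (\<lambda>c. of_bool (entry g \<phi> x c)) ?C) ?R"
    by (simp only: m[of "\<lambda>c. of_bool (entry g \<phi> _ c)"] m[of "\<lambda>x. map (\<lambda>c. of_bool (entry g \<phi> x c)) ?C"])
  finally show ?thesis by (simp add: encode_dv_def dv_matrix_def)
qed

section \<open>The reduction as a program\<close>

text \<open>Divides \<open>rV\<close> by \<open>g\<close> by counting down cyclically, and halves \<open>rX\<close> at each wrap-around; the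
  start value \<open>i\<close> of \<open>rY\<close> makes it end at 0 exactly if \<open>rV mod g = i\<close>.\<close>

definition lookup :: "nat \<Rightarrow> cmd" where
  "lookup g = Loop rV (IfZ rY (Blk [Const rY (g - 1), Half rX rX]) (Blk [Sub rY rY rOne]))"

lemma wregs_lookup [simp]: "wregs (lookup g) = {rOne, rV, rX, rY}"
  by (auto simp: lookup_def)

lemma wp_lookup:
  assumes g: "R rY < g"
    and Q: "\<And>R' t. \<forall>x. x \<notin> {rOne, rV, rX, rY} \<longrightarrow> R' x = R x \<Longrightarrow>
      R' rY = 0 \<longleftrightarrow> R rV mod g = R rY \<Longrightarrow>
      (R rV mod g = R rY \<Longrightarrow> R' rX = R rX div 2 ^ (R rV div g)) \<Longrightarrow>
      t \<le> 1 + 7 * R rV \<Longrightarrow> Q R' h t"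
  shows "wp (lookup g) Q R h"
  unfolding lookup_def
\<comment> \<open>\<open>w\<close> counts the wrap-arounds so far: the consumed part of
  \<open>rV\<close> plus the current count is the start value plus \<open>g * w\<close>.\<close>
proof (rule wp_Loop[where N = "R rV" and T = 3 and I = "\<lambda>n R1 h1. h1 = h \<and> R1 rY < g \<and>
    (\<exists>w. R rV - n + R1 rY = R rY + g * w \<and> R1 rX = R rX div 2 ^ w)"])
  show "h = h \<and> R rY < g \<and> (\<exists>w. R rV - R rV + R rY = R rY + g * w \<and> R rX = R rX div 2 ^ w)"
    using g by (auto intro: exI[of _ 0])
next
  fix n R1 h1
  assume n: "n < R rV" and "h1 = h \<and> R1 rY < g \<and>
    (\<exists>w. R rV - Suc n + R1 rY = R rY + g * w \<and> R1 rX = R rX div 2 ^ w)"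
  then obtain w where w: "h1 = h" "R1 rY < g" "R rV - Suc n + R1 rY = R rY + g * w"
    "R1 rX = R rX div 2 ^ w" by blast
  have "\<exists>w'. R rV - n + (if R1 rY = 0 then g - 1 else R1 rY - 1) = R rY + g * w' \<and>
     (if R1 rY = 0 then R1 rX div 2 else R1 rX) = R rX div 2 ^ w'"
  proof (cases "R1 rY = 0")
    case True
    have "R rX div 2 ^ w div 2 = R rX div 2 ^ Suc w" by (simp only: power_Suc2 div_mult2_eq)
    with True show ?thesis using w n by (intro exI[of _ "Suc w"]) auto
  next
    case False
    then show ?thesis using w n by (intro exI[of _ w]) auto
  qed
  then show "wp (IfZ rY (Blk [Const rY (g - 1), Half rX rX]) (Blk [Sub rY rY rOne]))
      (\<lambda>R2 h2 t. (h2 = h \<and> R2 rY < g \<and>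
        (\<exists>w. R rV - n + R2 rY = R rY + g * w \<and> R2 rX = R rX div 2 ^ w)) \<and> t \<le> 3)
      (R1(rOne := 1, rV := n)) h1"
    using w by (auto split: if_splits)
next
  fix R' h' t
  assume "h' = h \<and> R' rY < g \<and>
    (\<exists>w. R rV - 0 + R' rY = R rY + g * w \<and> R' rX = R rX div 2 ^ w)"
  then obtain w where w: "h' = h" "R' rY < g" "R rV + R' rY = R rY + g * w"
    "R' rX = R rX div 2 ^ w" by auto
  assume f: "\<forall>x. x \<notin> wregs (Loop rV (IfZ rY (Blk [Const rY (g - 1), Half rX rX]) (Blk [Sub rY rY rOne])))
     \<longrightarrow> R' x = R x" and t: "t \<le> 1 + R rV * (3 + 4)"
  have iff: "R' rY = 0 \<longleftrightarrow> R rV mod g = R rY"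
  proof
    assume "R rV mod g = R rY"
    \<comment> \<open>The final count is thus a multiple of \<open>g\<close>; being below
      \<open>g\<close>, it is 0.\<close>
    then have "R rY + g * (R rV div g) + R' rY = R rY + g * w" using w(3) by (metis mod_mult_div_eq)
    then have "g * (R rV div g) + R' rY = g * w" by simp
    then have "R' rY mod g = 0" by (metis mod_mult_self2 mod_mult_self1_is_0 add.commute)
    then show "R' rY = 0" using w(2) by simp
  next
    assume "R' rY = 0"
    then show "R rV mod g = R rY" using w(3) g by simp
  qed
  moreover have "R' rX = R rX div 2 ^ (R rV div g)" if "R rV mod g = R rY"
  proof -
    have "R rV = R rY + g * w" using iff that w(3) by simp
    then show ?thesis using w(4) g by simp
  qed
  ultimately have "Q R' h t" using f t by (intro Q) auto
  with w(1) show "Q R' h' t" by simp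
qed auto

section \<open>Evaluating a matrix entry\<close>

definition clause_at :: "(nat \<Rightarrow> nat) \<Rightarrow> nat \<Rightarrow> clause \<Rightarrow> bool" where
  "clause_at h q cl \<longleftrightarrow>
     h q = length cl \<and> (\<forall>j<length cl. h (q + 1 + j) = encode_literal (cl ! j))"

text \<open>Truncated subtraction tests \<open>x = y\<close> as \<open>(x - y) + (y - x) = 0\<close>.\<close>

definition scan_clause :: "nat \<Rightarrow> cmd" where
  "scan_clause g = Loop rLen
     (Blk [Read rLit rP, Add rP rP rOne, Half rV rLit, Sub rPar rLit rV, Sub rPar rPar rV,
           Add rY rI rZero, Add rX rA rZero] ;;
      lookup g ;;
      IfZ rY
        (Blk [Half rZ rX, Sub rX rX rZ, Sub rX rX rZ, Sub rZ rX rPar, Sub rX rPar rX, Add rZ rZ rX] ;;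
         IfZ rZ (Blk [Const rVal 1]) (Blk []))
        (Blk []))"

lemma wregs_scan_clause [simp]:
  "wregs (scan_clause g) = {rOne, rX, rY, rV, rVal, rLen, rP, rLit, rPar, rZ}"
  by (auto simp: scan_clause_def)

text \<open>Halving undoes \<open>encode_literal\<close>: the quotient is the variable, the
  remainder its required value. A literal holds if \<open>lookup\<close> confirms group
  \<open>rI\<close> and the lowest bit left in \<open>rX\<close> equals that value.\<close>

lemma wp_scan_clause:
  assumes R: "R rZero = 0" "R rI < g" "R rLen = length cl" "R rVal = 0"
    and cl: "\<And>j. j < length cl \<Longrightarrow> h (R rP + j) = encode_literal (cl ! j)"
    and vars: "\<And>v b. (v, b) \<in> set cl \<Longrightarrow> v \<le> V"
    and Q: "\<And>R' t. \<forall>x. x \<notin> wregs (scan_clause g) \<longrightarrow> R' x = R x \<Longrightarrow>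
      R' rVal = of_bool (\<exists>l\<in>set cl. lit_holds g (R rI) (R rA) l) \<Longrightarrow>
      t \<le> 1 + length cl * (40 + 7 * V) \<Longrightarrow> Q R' h t"
  shows "wp (scan_clause g) Q R h"
  unfolding scan_clause_def
proof -
  define J where "J n R1 h1 \<longleftrightarrow> h1 = h \<and> R1 rP = R rP + (length cl - n) \<and>
      R1 rVal = of_bool (\<exists>l\<in>set (take (length cl - n) cl). lit_holds g (R rI) (R rA) l)" for n R1 h1
  show "wp (Loop rLen
     (Blk [Read rLit rP, Add rP rP rOne, Half rV rLit, Sub rPar rLit rV, Sub rPar rPar rV,
           Add rY rI rZero, Add rX rA rZero] ;;
      lookup g ;;
      IfZ rY
        (Blk [Half rZ rX, Sub rX rX rZ, Sub rX rX rZ, Sub rZ rX rPar, Sub rX rPar rX, Add rZ rZ rX] ;;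
         IfZ rZ (Blk [Const rVal 1]) (Blk []))
        (Blk []))) Q R h"
  proof (rule wp_Loop[where N = "length cl" and T = "36 + 7 * V" and I = J], goal_cases)
    case (5 n R1 h1)
    then have I: "h1 = h" "R1 rP = R rP + (length cl - Suc n)"
      "R1 rVal = of_bool (\<exists>l\<in>set (take (length cl - Suc n) cl). lit_holds g (R rI) (R rA) l)"
      and fr: "R1 rZero = 0" "R1 rI = R rI" "R1 rA = R rA" and n: "n < length cl"
      using R by (auto simp: J_def)
    let ?j = "length cl - Suc n"
    have j: "?j < length cl" "length cl - n = Suc ?j" using n by auto
    obtain v b where l: "cl ! ?j = (v, b)" by fastforce
    have v: "v \<le> V" using vars j(1) l by (metis nth_mem)
    define p :: nat where "p = of_bool b"
    have lit: "h (R1 rP) = 2 * v + p"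
      using cl[OF j(1)] I(2) l by (simp add: encode_literal_def p_def)
    have half: "(2 * v + p) div 2 = v" "2 * v + p - v - v = p" by (auto simp: p_def)
    have take: "take (length cl - n) cl = take ?j cl @ [(v, b)]"
      using j l by (simp add: take_Suc_conv_app_nth)
    \<comment> \<open>The left side is what simplification makes of the equality test between the
      lowest bit of \<open>y\<close> and \<open>p\<close>: both truncated differences are 0.\<close>
    have key: "y \<le> y div 2 + y div 2 + p \<and> p + (y div 2 + y div 2) \<le> y \<longleftrightarrow> odd y = b" for y
      unfolding p_def by (cases b; cases "odd y"; simp; presburger)
    have J: "J n R' h" if "R' rP = R1 rP + 1"
      "R' rVal = (if lit_holds g (R rI) (R rA) (v, b) then 1 else R1 rVal)" for R'
      using that I unfolding J_def take by (auto simp: j)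
    show ?case
      apply (simp only: wp_Seq wp_Blk I(1))
      apply (simp add: lit half fr del: One_nat_def)
      apply (rule wp_lookup)
       apply (use R in simp)
      subgoal for R' t
        using v key[of "R' rX"]
        by (cases "R' rY = 0"; cases "odd (R' rX) = b") (auto simp: fr lit_holds_def intro!: J)
      done
  next
    case (6 R' h' t)
    then have "Q R' h t" by (intro Q) (auto simp: J_def scan_clause_def algebra_simps)
    with 6 show ?case by (simp add: J_def)
  qed (use R in \<open>auto simp: J_def\<close>)
qed

text \<open>Leaves in \<open>rVal\<close> the entry for tag \<open>rT\<close>, row kind
  \<open>rB\<close> and assignment \<open>rA\<close> of group \<open>rI\<close>; \<open>rQ\<close>
  is the address of the clause. \<open>rZ\<close> is 0 exactly for filler tags, where only the
  residue matters.\<close>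

definition test_row :: "nat \<Rightarrow> cmd" where
  "test_row g = Blk [Const rVal 0] ;; IfZ rB (Blk []) (Blk [Sub rZ rM rT] ;;
     IfZ rZ
       (Blk [Sub rV rT rM, Add rY rI rZero, Add rX rA rZero] ;; lookup g ;;
        IfZ rY (Blk [Const rVal 1]) (Blk []))
       (Blk [Const rOne 1, Add rP rQ rOne, Read rLen rQ] ;; scan_clause g))"

lemma wregs_test_row [simp]:
  "wregs (test_row g) = {rOne, rX, rY, rV, rVal, rLen, rP, rLit, rPar, rZ}"
  by (auto simp: test_row_def)

text \<open>\<open>V\<close> bounds all that \<open>lookup\<close> divides, the variables and the
  filler number. Clauses have at most three literals, so the time is linear in
  \<open>V\<close>.\<close>

lemma wp_test_row:
  assumes R: "R rZero = 0" "R rI < g" "R rM = length \<phi>"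
    and cl: "R rT < length \<phi> \<Longrightarrow> clause_at h (R rQ) (\<phi> ! R rT)"
    and \<phi>: "is_3cnf r \<phi>" and V: "R rT \<le> V" "r \<le> V"
    and Q: "\<And>R' t. \<forall>x. x \<notin> wregs (test_row g) \<longrightarrow> R' x = R x \<Longrightarrow>
      R' rVal = of_bool (R rB \<noteq> 0 \<and> sat g \<phi> (R rT) (R rI) (R rA)) \<Longrightarrow>
      t \<le> 200 + 30 * V \<Longrightarrow> Q R' h t"
  shows "wp (test_row g) Q R h"
proof -
  consider "R rB = 0" | "R rB \<noteq> 0" "R rM \<le> R rT" | "R rB \<noteq> 0" "R rT < R rM" by linarith
  then show ?thesis
  proof cases
    case 1
    then show ?thesis by (auto simp: test_row_def intro!: Q)
  next
    case 2
    then have "sat g \<phi> (R rT) (R rI) (R rA) \<longleftrightarrow> (R rT - R rM) mod g = R rI"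
      by (simp add: sat_def R)
    with 2 R(1,2) V show ?thesis
      unfolding test_row_def
      apply simp
      apply (rule wp_lookup)
       apply simp
      apply (auto intro!: Q)
      done
  next
    case 3
    let ?cl = "\<phi> ! R rT"
    have "?cl \<in> set \<phi>" using 3 R by simp
    then have len: "length ?cl \<le> 3" using \<phi> unfolding is_3cnf_def by blast
    have vars: "v \<le> V" if "(v, b) \<in> set ?cl" for v b
      using \<open>?cl \<in> set \<phi>\<close> \<phi> V that unfolding is_3cnf_def by fastforce
    have time: "length ?cl * (40 + 7 * V) \<le> 3 * (40 + 7 * V)" using len by (rule mult_le_mono1)
    have at: "h (R rQ) = length ?cl" "\<And>j. j < length ?cl \<Longrightarrow> h (R rQ + 1 + j) = encode_literal (?cl ! j)"
      using cl 3 R unfolding clause_at_def by auto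
    have sat: "sat g \<phi> (R rT) (R rI) (R rA) \<longleftrightarrow> (\<exists>l\<in>set ?cl. lit_holds g (R rI) (R rA) l)"
      using 3 R by (simp add: sat_def)
    from 3 show ?thesis
      unfolding test_row_def
      apply simp
      apply (rule wp_scan_clause[where cl = ?cl and V = V])
           apply (use R at vars in \<open>simp_all\<close>)
      subgoal for R' t using time by (intro Q) (auto simp: sat)
      done
  qed
qed

section \<open>Writing the matrix\<close>

definition emit :: cmd where
  "emit = Blk [Const rOne 1, Write rO rVal, Add rO rO rOne]"

lemma wregs_emit [simp]: "wregs emit = {rOne, rO}"
  by (auto simp: emit_def)

definition written :: "(nat \<Rightarrow> nat) \<Rightarrow> nat \<Rightarrow> nat list \<Rightarrow> nat \<Rightarrow> nat" where
  "written h off xs = (\<lambda>a. if off \<le> a \<and> a - off < length xs then xs ! (a - off) else h a)"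

lemma written_Nil [simp]: "written h off [] = h"
  by (auto simp: written_def)

lemma written_snoc: "(written h off xs)(off + length xs := v) = written h off (xs @ [v])"
  by (auto simp: written_def fun_eq_iff nth_append)

text \<open>The output starts behind the clauses, so they stay readable while it is written.\<close>

lemma clause_at_written:
  "clause_at h q cl \<Longrightarrow> q + length cl < off \<Longrightarrow> clause_at (written h off xs) q cl"
  by (auto simp: clause_at_def written_def)

lemma wp_emit:
  assumes "h = written h0 (R rOff) xs" "R rO = R rOff + length xs"
    and "\<And>R' t. \<forall>x. x \<notin> wregs emit \<longrightarrow> R' x = R x \<Longrightarrow> R' rO = R rOff + length (xs @ [R rVal]) \<Longrightarrow>
      t = 3 \<Longrightarrow> Q R' (written h0 (R rOff) (xs @ [R rVal])) t"
  shows "wp emit Q R h"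
  using assms(1,2) by (auto simp: emit_def written_snoc intro!: assms(3))

definition emit_bits :: cmd where
  "emit_bits = Blk [Add rX rT rZero, Add rLen rBits rZero] ;;
     Loop rLen (Blk [Half rZ rX, Sub rVal rX rZ, Sub rVal rVal rZ, Add rX rZ rZero] ;; emit)"

lemma wregs_emit_bits [simp]: "wregs emit_bits = {rOne, rO, rX, rLen, rZ, rVal}"
  by (auto simp: emit_bits_def)

text \<open>The memory is always described as the original \<open>h0\<close> overwritten by the
  output so far. \<open>ys\<close> enters through an equation, so that a caller can present the
  extended list in its own form.\<close>

lemma wp_emit_bits:
  assumes R: "R rZero = 0" "h = written h0 (R rOff) xs" "R rO = R rOff + length xs"
    and ys: "ys = xs @ map (\<lambda>j. of_bool (odd (R rT div 2 ^ j))) [0..<R rBits]"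
    and Q: "\<And>R' t. \<forall>x. x \<notin> wregs emit_bits \<longrightarrow> R' x = R x \<Longrightarrow> R' rO = R rOff + length ys \<Longrightarrow>
      t \<le> 3 + 11 * R rBits \<Longrightarrow> Q R' (written h0 (R rOff) ys) t"
  shows "wp emit_bits Q R h"
proof -
  define zs where "zs n = xs @ map (\<lambda>j. of_bool (odd (R rT div 2 ^ j))) [0..<R rBits - n]" for n
  define J where "J n R1 h1 \<longleftrightarrow> h1 = written h0 (R rOff) (zs n) \<and> R1 rO = R rOff + length (zs n) \<and>
    R1 rX = R rT div 2 ^ (R rBits - n)" for n R1 h1
  have zs0: "zs 0 = ys" by (simp add: zs_def ys)
  have bit: "x - x div 2 - x div 2 = of_bool (odd x)" for x :: nat
    by (cases "odd x") (simp_all, presburger+)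
  show ?thesis
    unfolding emit_bits_def
    apply (simp only: wp_Seq wp_Blk)
    apply simp
    apply (rule wp_Loop[where N = "R rBits" and T = 7 and I = J])
    subgoal using R by simp
    subgoal using R by (simp add: J_def zs_def)
    subgoal by simp
    subgoal by simp
    subgoal premises prems for n R1 h1
    proof -
      have J: "J (Suc n) R1 h1" and n: "n < R rBits" and fr: "R1 rZero = 0" "R1 rOff = R rOff"
        using prems R by auto
      have zs: "zs n = zs (Suc n) @ [of_bool (odd (R1 rX))]"
        using n J by (simp add: zs_def J_def Suc_diff_Suc[symmetric])
      have div: "R1 rX div 2 = R rT div 2 ^ (R rBits - n)"
        using n J by (simp add: J_def Suc_diff_Suc[symmetric] div_mult2_eq[symmetric] mult.commute)
      show ?thesis
        apply (simp only: wp_Seq wp_Blk)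
        apply (simp add: fr)
        apply (rule wp_emit)
        using J fr div bit[of "R1 rX"] by (auto simp: J_def zs)
    qed
    subgoal for R' h' t by (auto simp: J_def zs0 intro!: Q)
    done
qed

text \<open>The loop counter is itself the assignment: decremented before each pass, it runs down
  from one below \<open>rS\<close> to 0, hence \<open>rev\<close> in \<open>col_ids\<close>. The
  counter \<open>rI\<close> of \<open>emit_row\<close> enumerates the groups likewise.\<close>

definition emit_group :: "nat \<Rightarrow> cmd" where
  "emit_group g = Blk [Add rA rS rZero] ;; Loop rA (test_row g ;; emit)"

lemma wregs_emit_group [simp]:
  "wregs (emit_group g) = {rOne, rX, rY, rV, rVal, rLen, rP, rLit, rPar, rZ, rO, rA}"
  by (auto simp: emit_group_def)

definition test_time :: "nat \<Rightarrow> nat" where "test_time V = 200 + 30 * V"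
definition group_time :: "nat \<Rightarrow> nat \<Rightarrow> nat" where "group_time V S = 2 + S * (test_time V + 7)"

lemma wp_emit_group:
  assumes R: "R rZero = 0" "R rI < g" "R rM = length \<phi>"
    and out: "h = written h0 (R rOff) xs" "R rO = R rOff + length xs"
    and cl: "R rT < length \<phi> \<Longrightarrow> clause_at h0 (R rQ) (\<phi> ! R rT) \<and> R rQ + length (\<phi> ! R rT) < R rOff"
    and \<phi>: "is_3cnf r \<phi>" and V: "R rT \<le> V" "r \<le> V"
    and ys: "ys = xs @ map (\<lambda>a. of_bool (entry g \<phi> (R rT, R rB \<noteq> 0) (Inr (R rI, a)))) (rev [0..<R rS])"
    and Q: "\<And>R' t. \<forall>x. x \<notin> wregs (emit_group g) \<longrightarrow> R' x = R x \<Longrightarrow> R' rO = R rOff + length ys \<Longrightarrow>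
      t \<le> group_time V (R rS) \<Longrightarrow> Q R' (written h0 (R rOff) ys) t"
  shows "wp (emit_group g) Q R h"
proof -
  define zs where "zs n = xs @ map (\<lambda>a. of_bool (entry g \<phi> (R rT, R rB \<noteq> 0) (Inr (R rI, a)))) (rev [n..<R rS])" for n
  define J where "J n R1 h1 \<longleftrightarrow> h1 = written h0 (R rOff) (zs n) \<and> R1 rO = R rOff + length (zs n)"
    for n R1 h1
  have zs0: "zs 0 = ys" by (simp add: zs_def ys)
  show ?thesis
    unfolding emit_group_def
    apply (simp only: wp_Seq wp_Blk)
    apply simp
    apply (rule wp_Loop[where N = "R rS" and T = "test_time V + 3" and I = J])
    subgoal using R by simp
    subgoal using out by (simp add: J_def zs_def)
    subgoal by simp
    subgoal by simp
    subgoal premises prems for n R1 h1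
    proof -
      have J: "J (Suc n) R1 h1" and n: "n < R rS" and fr: "R1 rZero = 0" "R1 rOff = R rOff"
        "R1 rI = R rI" "R1 rM = length \<phi>" "R1 rT = R rT" "R1 rQ = R rQ" "R1 rB = R rB"
        using prems R by auto
      have zs: "zs n = zs (Suc n) @ [of_bool (R rB \<noteq> 0 \<and> sat g \<phi> (R rT) (R rI) n)]"
        using n by (simp add: zs_def upt_conv_Cons)
      show ?thesis
        apply (simp only: wp_Seq)
        apply (rule wp_test_row[where \<phi> = \<phi> and r = r and V = V])
        subgoal using fr by simp
        subgoal using fr R by simp
        subgoal using fr by simp
        subgoal using cl J fr by (auto simp: J_def intro!: clause_at_written)
        subgoal by (rule \<phi>)
        subgoal using fr V by simp
        subgoal by (rule V)
        subgoal for R2 t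
          apply (rule wp_emit)
            apply (use J fr in \<open>auto simp: J_def zs test_time_def\<close>)
          done
        done
    qed
    subgoal for R' h' t by (auto simp: J_def zs0 group_time_def algebra_simps intro!: Q)
    done
qed

definition emit_row :: "nat \<Rightarrow> cmd" where
  "emit_row g = emit_bits ;; Blk [Const rI g] ;; Loop rI (emit_group g)"

lemma wregs_emit_row [simp]:
  "wregs (emit_row g) = {rOne, rX, rY, rV, rVal, rLen, rP, rLit, rPar, rZ, rO, rA, rI}"
  by (auto simp: emit_row_def)

definition row_time :: "nat \<Rightarrow> nat \<Rightarrow> nat \<Rightarrow> nat \<Rightarrow> nat" where
  "row_time V g b S = 5 + 11 * b + g * (group_time V S + 4)"

definition row_word :: "nat \<Rightarrow> nat \<Rightarrow> nat \<Rightarrow> cnf \<Rightarrow> row_id \<Rightarrow> nat list" where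
  "row_word g b S \<phi> x = map (\<lambda>c. of_bool (entry g \<phi> x c)) (col_ids g b S)"

lemma wp_emit_row:
  assumes R: "R rZero = 0" "R rM = length \<phi>"
    and out: "h = written h0 (R rOff) xs" "R rO = R rOff + length xs"
    and cl: "R rT < length \<phi> \<Longrightarrow> clause_at h0 (R rQ) (\<phi> ! R rT) \<and> R rQ + length (\<phi> ! R rT) < R rOff"
    and \<phi>: "is_3cnf r \<phi>" and V: "R rT \<le> V" "r \<le> V"
    and ys: "ys = xs @ row_word g (R rBits) (R rS) \<phi> (R rT, R rB \<noteq> 0)"
    and Q: "\<And>R' t. \<forall>x. x \<notin> wregs (emit_row g) \<longrightarrow> R' x = R x \<Longrightarrow> R' rO = R rOff + length ys \<Longrightarrow>
      t \<le> row_time V g (R rBits) (R rS) \<Longrightarrow> Q R' (written h0 (R rOff) ys) t"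
  shows "wp (emit_row g) Q R h"
proof -
  define bits where "bits = xs @ map (\<lambda>j. of_bool (odd (R rT div 2 ^ j))) [0..<R rBits]"
  define zs where "zs n = bits @ concat (map (\<lambda>i. map (\<lambda>a. of_bool (entry g \<phi> (R rT, R rB \<noteq> 0) (Inr (i, a))))
    (rev [0..<R rS])) (rev [n..<g]))" for n
  define J where "J n R1 h1 \<longleftrightarrow> h1 = written h0 (R rOff) (zs n) \<and> R1 rO = R rOff + length (zs n)"
    for n R1 h1
  have zs0: "zs 0 = ys"
    by (simp add: zs_def ys row_word_def col_ids_def bits_def map_concat comp_def)
  show ?thesis
    unfolding emit_row_def
    apply (simp only: wp_Seq)
    apply (rule wp_emit_bits)
        apply (rule R out)+
     apply (rule bits_def)
    apply (simp only: wp_Blk)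
    apply simp
    subgoal for R0 t0
      apply (rule wp_Loop[where N = g and T = "group_time V (R rS)" and I = J])
      subgoal by simp
      subgoal by (simp add: J_def zs_def)
      subgoal by simp
      subgoal by simp
      subgoal premises prems for n R1 h1
      proof -
        have J: "J (Suc n) R1 h1" and n: "n < g" and fr: "R1 rZero = 0" "R1 rOff = R rOff"
          "R1 rS = R rS" "R1 rM = length \<phi>" "R1 rT = R rT" "R1 rQ = R rQ" "R1 rB = R rB"
          using prems R by auto
        have zs: "zs n = zs (Suc n) @ map (\<lambda>a. of_bool (entry g \<phi> (R rT, R rB \<noteq> 0) (Inr (n, a)))) (rev [0..<R rS])"
          using n by (simp add: zs_def upt_conv_Cons)
        show ?thesis
          apply (rule wp_emit_group[where \<phi> = \<phi> and r = r and V = V and ?h0.0 = h0 and xs = "zs (Suc n)" and ys = "zs n"])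
          subgoal using fr by simp
          subgoal using n by simp
          subgoal using fr by simp
          subgoal using J fr by (simp add: J_def)
          subgoal using J fr by (simp add: J_def)
          subgoal using cl fr by simp
          subgoal by (rule \<phi>)
          subgoal using fr V by simp
          subgoal by (rule V)
          subgoal unfolding zs using fr by simp
          subgoal using fr by (auto simp: J_def)
          done
      qed
      subgoal for R' h' t by (auto simp: J_def zs0 row_time_def algebra_simps intro!: Q)
      done
    done
qed

text \<open>\<open>rB\<close> takes the values 1 and 0, for the marking row and the 0-row. Then
  \<open>rQ\<close> moves past the length cell and the literals of the clause; on filler tags its
  value is meaningless.\<close>

definition emit_tag :: "nat \<Rightarrow> cmd" where
  "emit_tag g = Blk [Const rB 2] ;; Loop rB (emit_row g) ;;
     Blk [Read rZ rQ, Const rOne 1, Add rQ rQ rZ, Add rQ rQ rOne, Add rT rT rOne]"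

lemma wregs_emit_tag [simp]:
  "wregs (emit_tag g) =
    {rOne, rX, rY, rV, rVal, rLen, rP, rLit, rPar, rZ, rO, rA, rI, rB, rQ, rT}"
  by (auto simp: emit_tag_def)

definition tag_time :: "nat \<Rightarrow> nat \<Rightarrow> nat \<Rightarrow> nat \<Rightarrow> nat" where
  "tag_time V g b S = 7 + 2 * (row_time V g b S + 4)"

lemma wp_emit_tag:
  assumes R: "R rZero = 0" "R rM = length \<phi>"
    and out: "h = written h0 (R rOff) xs" "R rO = R rOff + length xs"
    and cl: "R rT < length \<phi> \<Longrightarrow> clause_at h0 (R rQ) (\<phi> ! R rT) \<and> R rQ + length (\<phi> ! R rT) < R rOff"
    and \<phi>: "is_3cnf r \<phi>" and V: "R rT \<le> V" "r \<le> V"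
    and ys: "ys = xs @ row_word g (R rBits) (R rS) \<phi> (R rT, True) @ row_word g (R rBits) (R rS) \<phi> (R rT, False)"
    and Q: "\<And>R' t. \<forall>x. x \<notin> wregs (emit_tag g) \<longrightarrow> R' x = R x \<Longrightarrow> R' rO = R rOff + length ys \<Longrightarrow>
      R' rT = Suc (R rT) \<Longrightarrow>
      (R rT < length \<phi> \<Longrightarrow> R' rQ = R rQ + 1 + length (\<phi> ! R rT)) \<Longrightarrow>
      t \<le> tag_time V g (R rBits) (R rS) \<Longrightarrow> Q R' (written h0 (R rOff) ys) t"
  shows "wp (emit_tag g) Q R h"
proof -
  define zs where "zs n = xs @ concat (map (\<lambda>b. row_word g (R rBits) (R rS) \<phi> (R rT, b \<noteq> 0)) (rev [n..<2]))" for n :: nat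
  define J where "J n R1 h1 \<longleftrightarrow> h1 = written h0 (R rOff) (zs n) \<and> R1 rO = R rOff + length (zs n)"
    for n R1 h1
  have zs0: "zs 0 = ys" by (simp add: zs_def ys upt_conv_Cons)
  show ?thesis
    unfolding emit_tag_def
    apply (simp only: wp_Seq wp_Blk)
    apply simp
    apply (rule wp_Loop[where N = 2 and T = "row_time V g (R rBits) (R rS)" and I = J])
    subgoal by simp
    subgoal using out by (simp add: J_def zs_def)
    subgoal by simp
    subgoal by simp
    subgoal premises prems for n R1 h1
    proof -
      have J: "J (Suc n) R1 h1" and n: "n < 2" and fr: "R1 rZero = 0" "R1 rOff = R rOff"
        "R1 rS = R rS" "R1 rM = length \<phi>" "R1 rT = R rT" "R1 rQ = R rQ" "R1 rBits = R rBits"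
        using prems R by auto
      have zs: "zs n = zs (Suc n) @ row_word g (R rBits) (R rS) \<phi> (R rT, n \<noteq> 0)"
        using n by (simp add: zs_def upt_conv_Cons)
      show ?thesis
        apply (rule wp_emit_row[where \<phi> = \<phi> and r = r and V = V and ?h0.0 = h0 and xs = "zs (Suc n)" and ys = "zs n"])
        subgoal using fr by simp
        subgoal using fr by simp
        subgoal using J fr by (simp add: J_def)
        subgoal using J fr by (simp add: J_def)
        subgoal using cl fr by simp
        subgoal by (rule \<phi>)
        subgoal using fr V by simp
        subgoal by (rule V)
        subgoal unfolding zs using fr by simp
        subgoal using fr by (auto simp: J_def)
        done
    qed
    subgoal premises prems for R' h' t
    proof -
      have fr: "R' rOff = R rOff" "R' rT = R rT" "R' rQ = R rQ" and J: "J 0 R' h'"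
        using prems by auto
      have "h' (R rQ) = length (\<phi> ! R rT)" if "R rT < length \<phi>"
        using clause_at_written[of h0 "R rQ" "\<phi> ! R rT" "R rOff" ys] cl[OF that] J
        by (simp add: J_def zs0 clause_at_def)
      with prems J fr show ?thesis
        by (auto simp: J_def zs0 tag_time_def intro!: Q)
    qed
    done
qed

text \<open>The 2 stands for the header cells of \<open>encode_cnf\<close>.\<close>

definition clause_pos :: "cnf \<Rightarrow> nat \<Rightarrow> nat" where
  "clause_pos \<phi> t = 2 + length (concat (map (\<lambda>cl. length cl # map encode_literal cl) (take t \<phi>)))"

lemma clause_pos_Suc: "t < length \<phi> \<Longrightarrow> clause_pos \<phi> (Suc t) = clause_pos \<phi> t + 1 + length (\<phi> ! t)"
  by (simp add: clause_pos_def take_Suc_conv_app_nth)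

lemma clause_at_encode_cnf:
  assumes "t < length \<phi>"
  shows "clause_at (mem (initial (encode_cnf (r, \<phi>)))) (clause_pos \<phi> t) (\<phi> ! t)"
proof -
  let ?e = "\<lambda>cl. length cl # map encode_literal cl"
  let ?w = "encode_cnf (r, \<phi>)"
  have "concat (map ?e \<phi>) = concat (map ?e (take t \<phi>)) @ ?e (\<phi> ! t) @ concat (map ?e (drop (Suc t) \<phi>))"
    using arg_cong[OF id_take_nth_drop[OF assms], of "\<lambda>x. concat (map ?e x)"] by simp
  then have w: "?w = (r # length \<phi> # concat (map ?e (take t \<phi>))) @ ?e (\<phi> ! t) @ concat (map ?e (drop (Suc t) \<phi>))"
    by (simp add: encode_cnf_def)
  have "?w ! (clause_pos \<phi> t + j) = ?e (\<phi> ! t) ! j \<and> clause_pos \<phi> t + j < length ?w"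
    if "j < length (?e (\<phi> ! t))" for j
    unfolding w clause_pos_def using that by (simp add: nth_append del: append_Cons)
  note * = this[of 0] this[of "Suc _"]
  show ?thesis unfolding clause_at_def initial_def using * by simp
qed

text \<open>A clause takes a length cell and at most three literals. For
  \<open>t = length \<phi>\<close> this shows that the input fits below
  \<open>2 + 4 * length \<phi>\<close>, where the output starts.\<close>

lemma clause_pos_bound:
  assumes "is_3cnf r \<phi>" "t \<le> length \<phi>"
  shows "clause_pos \<phi> t \<le> 2 + 4 * t"
  using assms(2)
proof (induction t)
  case (Suc t)
  then have "length (\<phi> ! t) \<le> 3" using assms(1) by (simp add: is_3cnf_def)
  with Suc show ?case by (simp add: clause_pos_Suc)
qed (simp add: clause_pos_def)

definition emit_rows :: "nat \<Rightarrow> cmd" where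
  "emit_rows g = Blk [Const rOne 1, Add rQ rOne rOne, Const rT 0, Add rCnt rH rZero] ;; Loop rCnt (emit_tag g)"

lemma wregs_emit_rows [simp]:
  "wregs (emit_rows g) =
    {rOne, rX, rY, rV, rVal, rLen, rP, rLit, rPar, rZ, rO, rA, rI, rB, rQ, rT, rCnt}"
  by (auto simp: emit_rows_def)

lemma wp_emit_rows:
  assumes R: "R rZero = 0" "R rM = length \<phi>" "R rOff = 2 + 4 * length \<phi>"
    and h0: "h0 = mem (initial (encode_cnf (r, \<phi>)))"
    and out: "h = written h0 (R rOff) xs" "R rO = R rOff + length xs"
    and \<phi>: "is_3cnf r \<phi>" and V: "R rH \<le> V" "r \<le> V"
    and ys: "ys = xs @ concat (map (row_word g (R rBits) (R rS) \<phi>) (row_ids (R rH)))"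
    and Q: "\<And>R' t. \<forall>x. x \<notin> wregs (emit_rows g) \<longrightarrow> R' x = R x \<Longrightarrow>
      t \<le> 5 + R rH * (tag_time V g (R rBits) (R rS) + 4) \<Longrightarrow> Q R' (written h0 (R rOff) ys) t"
  shows "wp (emit_rows g) Q R h"
proof -
  define zs where "zs n = xs @ concat (map (row_word g (R rBits) (R rS) \<phi>) (row_ids (R rH - n)))" for n
  \<comment> \<open>\<open>R rH - n\<close> is the current tag; \<open>rQ\<close> is tracked up to
    the end of the last clause, not through the filler tags.\<close>
  define J where "J n R1 h1 \<longleftrightarrow> h1 = written h0 (R rOff) (zs n) \<and> R1 rO = R rOff + length (zs n) \<and>
      R1 rT = R rH - n \<and> (R rH - n \<le> length \<phi> \<longrightarrow> R1 rQ = clause_pos \<phi> (R rH - n))"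
    for n R1 h1
  have zs0: "zs 0 = ys" by (simp add: zs_def ys)
  show ?thesis
    unfolding emit_rows_def
    apply (simp only: wp_Seq wp_Blk)
    apply simp
    apply (rule wp_Loop[where N = "R rH" and T = "tag_time V g (R rBits) (R rS)" and I = J])
    subgoal using R by simp
    subgoal using out by (simp add: J_def zs_def row_ids_def clause_pos_def)
    subgoal by simp
    subgoal by simp
    subgoal premises prems for n R1 h1
    proof -
      have J: "J (Suc n) R1 h1" and n: "n < R rH" and fr: "R1 rZero = 0" "R1 rOff = R rOff"
        "R1 rS = R rS" "R1 rM = length \<phi>" "R1 rBits = R rBits"
        using prems R by auto
      let ?t = "R rH - Suc n"
      have t: "R rH - n = Suc ?t" using n by simp
      have zs: "zs n = zs (Suc n) @ row_word g (R rBits) (R rS) \<phi> (?t, True) @ row_word g (R rBits) (R rS) \<phi> (?t, False)"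
        unfolding zs_def t by (simp add: row_ids_def)
      have pos: "clause_pos \<phi> ?t + length (\<phi> ! ?t) < 2 + 4 * length \<phi>" if "?t < length \<phi>"
        using clause_pos_Suc[OF that] clause_pos_bound[OF \<phi>, of "Suc ?t"] that by simp
      show ?thesis
        apply (rule wp_emit_tag[where \<phi> = \<phi> and r = r and V = V and ?h0.0 = h0 and xs = "zs (Suc n)" and ys = "zs n"])
        subgoal using fr by simp
        subgoal using fr by simp
        subgoal using J fr by (simp add: J_def)
        subgoal using J fr by (simp add: J_def)
        subgoal using J fr pos clause_at_encode_cnf[of ?t \<phi> r] by (simp add: J_def R h0)
        subgoal by (rule \<phi>)
        subgoal using J V by (simp add: J_def)
        subgoal by (rule V)
        subgoal unfolding zs using J fr by (simp add: J_def)
        subgoal for R2 t2 using J fr clause_pos_Suc[of ?t \<phi>] by (auto simp: J_def t)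
        done
    qed
    subgoal for R' h' t by (auto simp: J_def zs0 algebra_simps intro!: Q)
    done
qed

section \<open>Computing the parameters\<close>

text \<open>The binary logarithm rounded up, with value 0 at 0.\<close>

definition bit_length :: "nat \<Rightarrow> nat" where "bit_length x = (LEAST b. x \<le> 2 ^ b)"

lemma bit_length_le_iff: "bit_length x \<le> b \<longleftrightarrow> x \<le> 2 ^ b"
proof
  have "x \<le> 2 ^ bit_length x"
    unfolding bit_length_def by (rule LeastI[of _ x]) (simp add: less_imp_le)
  also assume "bit_length x \<le> b"
  then have "2 ^ bit_length x \<le> (2 :: nat) ^ b" by simp
  finally show "x \<le> 2 ^ b" .
next
  assume "x \<le> 2 ^ b"
  then show "bit_length x \<le> b" unfolding bit_length_def by (rule Least_le)
qed

lemma power_bit_length_le: "x > 0 \<Longrightarrow> 2 ^ bit_length x \<le> 2 * x"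
proof (cases "bit_length x")
  case (Suc b)
  then have "2 ^ b < x" using bit_length_le_iff[of x b] by simp
  with Suc show ?thesis by simp
qed simp

lemma bit_length_le: "bit_length x \<le> x"
  by (simp add: bit_length_le_iff less_imp_le)

text \<open>For \<open>g > 0\<close> this is \<open>r / g\<close> rounded up, the size of the
  largest group.\<close>

definition num_blocks :: "nat \<Rightarrow> nat \<Rightarrow> nat" where "num_blocks g r = (r + g - 1) div g"

text \<open>\<open>y\<close> pads \<open>r\<close> to a multiple of \<open>g\<close>; the loop of
  \<open>block_size\<close> ends with such an equation.\<close>

lemma num_blocks_unique:
  assumes "r + y = g * w" "y < g"
  shows "num_blocks g r = w"
proof -
  define k where "k = g - 1 - y"
  have "r + g - 1 = k + g * w" "k < g" using assms by (simp_all add: k_def)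
  then show ?thesis by (simp add: num_blocks_def)
qed

lemma num_blocks_bounds:
  assumes "g > 0"
  shows "r \<le> g * num_blocks g r" "g * num_blocks g r < r + g"
proof -
  have "g * num_blocks g r + (r + g - 1) mod g = r + g - 1" by (simp add: num_blocks_def)
  moreover have "(r + g - 1) mod g < g" using assms by simp
  ultimately show "r \<le> g * num_blocks g r" "g * num_blocks g r < r + g" using assms by linarith+
qed

text \<open>\<open>C\<close> and \<open>g\<close> are built into the program, so \<open>C\<close>
  additions form \<open>C * r\<close>. \<open>rX\<close> becomes the number of tags to provide
  for.\<close>

definition load :: "nat \<Rightarrow> nat \<Rightarrow> cmd" where
  "load C g = Blk [Const rOne 1, Read rR rZero, Read rM rOne, Add rO rM rM, Add rO rO rO,
       Add rO rO rOne, Add rO rO rOne, Add rOff rO rZero, Const rX g, Const rLen C] ;;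
     Loop rLen (Blk [Add rX rX rR])"

lemma wregs_load [simp]: "wregs (load C g) = {rOne, rR, rM, rO, rOff, rX, rLen}"
  by (auto simp: load_def)

lemma wp_load:
  assumes R: "R rZero = 0" and h: "h = mem (initial (encode_cnf (r, \<phi>)))"
    and Q: "\<And>R' t. \<forall>x. x \<notin> wregs (load C g) \<longrightarrow> R' x = R x \<Longrightarrow> R' rR = r \<Longrightarrow> R' rM = length \<phi> \<Longrightarrow>
      R' rO = 2 + 4 * length \<phi> \<Longrightarrow> R' rOff = 2 + 4 * length \<phi> \<Longrightarrow> R' rX = g + C * r \<Longrightarrow>
      t \<le> 11 + 5 * C \<Longrightarrow> Q R' h t"
  shows "wp (load C g) Q R h"
proof -
  have [simp]: "h 0 = r" "h (Suc 0) = length \<phi>"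
    by (simp_all add: h initial_def encode_cnf_def)
  show ?thesis
    unfolding load_def
    apply (simp only: wp_Seq wp_Blk)
    apply (simp add: R)
    apply (rule wp_Loop[where N = C and T = 1 and
       I = "\<lambda>n R1 h1. h1 = h \<and> R1 rX = g + (C - n) * r"])
    subgoal by simp
    subgoal by simp
    subgoal by simp
    subgoal by simp
    subgoal for n R1 h1 by (simp add: Suc_diff_Suc[symmetric])
    subgoal for R' h' t by (auto intro!: Q)
    done
qed

definition round_up :: cmd where
  "round_up = Blk [Const rH 1, Const rBits 0, Add rLen rX rZero] ;;
     Loop rLen (Blk [Sub rZ rX rH] ;; IfZ rZ (Blk []) (Blk [Add rH rH rH, Add rBits rBits rOne]))"

lemma wregs_round_up [simp]: "wregs round_up = {rOne, rH, rBits, rLen, rZ}"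
  by (auto simp: round_up_def)

text \<open>\<open>rH\<close> doubles until it reaches \<open>rX\<close> and then stays; by
  \<open>bit_length_le\<close>, \<open>rX\<close> passes are enough.\<close>

lemma wp_round_up:
  assumes R: "R rZero = 0"
    and Q: "\<And>R' t. \<forall>x. x \<notin> wregs round_up \<longrightarrow> R' x = R x \<Longrightarrow> R' rBits = bit_length (R rX) \<Longrightarrow>
      R' rH = 2 ^ bit_length (R rX) \<Longrightarrow> t \<le> 4 + 9 * R rX \<Longrightarrow> Q R' h t"
  shows "wp round_up Q R h"
proof -
  define J where "J n R1 h1 \<longleftrightarrow> h1 = h \<and> R1 rBits = min (R rX - n) (bit_length (R rX)) \<and>
      R1 rH = 2 ^ min (R rX - n) (bit_length (R rX))" for n R1 h1
  have min0: "min (R rX) (bit_length (R rX)) = bit_length (R rX)"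
    using bit_length_le by (simp add: min_absorb2)
  show ?thesis
    unfolding round_up_def
    apply (simp only: wp_Seq wp_Blk)
    apply (simp add: R)
    apply (rule wp_Loop[where N = "R rX" and T = 5 and I = J])
    subgoal by simp
    subgoal by (simp add: J_def)
    subgoal by simp
    subgoal by simp
    subgoal premises prems for n R1 h1
    proof -
      define b where "b = min (R rX - Suc n) (bit_length (R rX))"
      have J: "h1 = h" "R1 rBits = b" "R1 rH = 2 ^ b" and n: "n < R rX" and fr: "R1 rX = R rX"
        using prems by (auto simp: J_def b_def)
      have "min (R rX - n) (bit_length (R rX)) = (if R rX \<le> 2 ^ b then b else Suc b)"
      proof (cases "bit_length (R rX) \<le> R rX - Suc n")
        case True
        then have "b = bit_length (R rX)" by (simp add: b_def)
        with True bit_length_le_iff[of "R rX" b] show ?thesis by simp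
      next
        case False
        then have b: "b = R rX - Suc n" by (simp add: b_def)
        with False bit_length_le_iff[of "R rX" b] n show ?thesis by auto
      qed
      then show ?thesis using J fr by (simp add: J_def)
    qed
    subgoal for R' h' t by (auto simp: J_def min0 intro!: Q)
    done
qed

text \<open>Counts cyclically as \<open>lookup\<close> does. Starting at 0, it wraps at the first of
  every \<open>g\<close> variables, doubling \<open>rS\<close> each time.\<close>

definition block_size :: "nat \<Rightarrow> cmd" where
  "block_size g = Blk [Const rS 1, Const rY 0, Add rLen rR rZero] ;;
     Loop rLen (IfZ rY (Blk [Const rY (g - 1), Add rS rS rS]) (Blk [Sub rY rY rOne]))"

lemma wregs_block_size [simp]: "wregs (block_size g) = {rOne, rS, rY, rLen}"
  by (auto simp: block_size_def)

lemma wp_block_size: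
  assumes R: "R rZero = 0" and g: "g > 0"
    and Q: "\<And>R' t. \<forall>x. x \<notin> wregs (block_size g) \<longrightarrow> R' x = R x \<Longrightarrow>
      R' rS = 2 ^ num_blocks g (R rR) \<Longrightarrow> t \<le> 4 + 7 * R rR \<Longrightarrow> Q R' h t"
  shows "wp (block_size g) Q R h"
proof -
  define J where "J n R1 h1 \<longleftrightarrow> h1 = h \<and> R1 rY < g \<and>
      (\<exists>w. R rR - n + R1 rY = g * w \<and> R1 rS = 2 ^ w)" for n R1 h1
  show ?thesis
    unfolding block_size_def
    apply (simp only: wp_Seq wp_Blk)
    apply (simp add: R)
    apply (rule wp_Loop[where N = "R rR" and T = 3 and I = J])
    subgoal by simp
    subgoal using g by (auto simp: J_def intro!: exI[of _ 0])
    subgoal by simp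
    subgoal by simp
    subgoal premises prems for n R1 h1
    proof -
      obtain w where w: "h1 = h" "R1 rY < g" "R rR - Suc n + R1 rY = g * w" "R1 rS = 2 ^ w"
        and n: "n < R rR" using prems by (auto simp: J_def)
      show ?thesis
      proof (cases "R1 rY = 0")
        case True
        with w n g have "R rR - n + (g - 1) = g * Suc w" "R1 rS + R1 rS = 2 ^ Suc w" by simp_all
        with True w g show ?thesis by (auto simp: J_def intro!: exI[of _ "Suc w"])
      next
        case False
        with w n show ?thesis by (auto simp: J_def intro!: exI[of _ w])
      qed
    qed
    subgoal for R' h' t by (auto simp: J_def num_blocks_unique intro!: Q)
    done
qed

definition emit_header :: "nat \<Rightarrow> cmd" where
  "emit_header g = Blk [Add rA rBits rZero, Const rLen g] ;; Loop rLen (Blk [Add rA rA rS]) ;;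
     Blk [Const rVal g, Add rVal rVal rBits] ;; emit ;; Blk [Add rVal rH rH] ;; emit ;;
     Blk [Add rVal rA rZero] ;; emit"

lemma wregs_emit_header [simp]: "wregs (emit_header g) = {rOne, rO, rA, rLen, rVal}"
  by (auto simp: emit_header_def)

lemma wp_emit_header:
  assumes R: "R rZero = 0" "R rO = R rOff"
    and Q: "\<And>R' t. \<forall>x. x \<notin> wregs (emit_header g) \<longrightarrow> R' x = R x \<Longrightarrow> R' rO = R rOff + 3 \<Longrightarrow>
      t \<le> 16 + 5 * g \<Longrightarrow>
      Q R' (written h (R rOff) [g + R rBits, 2 * R rH, R rBits + g * R rS]) t"
  shows "wp (emit_header g) Q R h"
  unfolding emit_header_def
  apply (simp only: wp_Seq wp_Blk)
  apply (simp add: R)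
  apply (rule wp_Loop[where N = g and T = 1 and
       I = "\<lambda>n R1 h1. h1 = h \<and> R1 rA = R rBits + (g - n) * R rS"])
  subgoal by simp
  subgoal by simp
  subgoal by simp
  subgoal by simp
  subgoal for n R1 h1 by (simp add: Suc_diff_Suc[symmetric])
  subgoal for R1 h1 t1
    apply (rule wp_emit[where xs = "[]" and ?h0.0 = h])
    subgoal by simp
    subgoal using R by simp
    subgoal for R2 t2
      apply simp
      apply (rule wp_emit[where xs = "[g + R rBits]" and ?h0.0 = h])
      subgoal by simp
      subgoal by simp
      subgoal for R3 t3
        apply simp
        apply (rule wp_emit[where xs = "[g + R rBits, 2 * R rH]" and ?h0.0 = h])
        subgoal by (simp add: mult_2)
        subgoal by simp
        subgoal for R4 t4 by (simp add: R) (rule Q; simp add: R)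
        done
      done
    done
  done

section \<open>The complete reduction\<close>

definition reduction :: "nat \<Rightarrow> nat \<Rightarrow> cmd" where
  "reduction C g = load C g ;; round_up ;; block_size g ;; emit_header g ;; emit_rows g"

text \<open>Adds up the bounds of the five phases; \<open>2 ^ b + r\<close> serves as the bound
  \<open>V\<close> on tags and variables.\<close>

definition reduction_time :: "nat \<Rightarrow> nat \<Rightarrow> nat \<Rightarrow> nat" where
  "reduction_time C g r = (let b = bit_length (g + C * r) in
     40 + 5 * C + 9 * (g + C * r) + 7 * r + 5 * g +
     2 ^ b * (tag_time (2 ^ b + r) g b (2 ^ num_blocks g r) + 4))"

text \<open>Values of \<open>ren\<close> are 0 or at least 31, so the relocated program finds all
  its registers 0.\<close>

lemma wregs_reduction: "wregs (reduction C g) \<subseteq> {2..<30} - {5, 28}"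
  by (auto simp: reduction_def)

lemma wf_reduction: "wf_cmd (reduction C g)"
  by (simp add: reduction_def load_def round_up_def block_size_def emit_header_def emit_rows_def
      emit_tag_def emit_row_def emit_bits_def emit_group_def test_row_def scan_clause_def lookup_def
      emit_def)

definition reduced :: "nat \<Rightarrow> nat \<Rightarrow> nat \<Rightarrow> cnf \<Rightarrow> bool mat \<times> nat" where
  "reduced C g r \<phi> = (let b = bit_length (g + C * r) in
     (dv_matrix g b (2 ^ b) (2 ^ num_blocks g r) \<phi>, g + b))"

text \<open>\<open>bit_length\<close> provides a tag for each clause and a filler tag for each
  group; \<open>num_blocks\<close>, being rounded up, provides a bit for each variable.\<close>

lemma distinct_vectors_reduced:
  assumes "is_3cnf r \<phi>" "length \<phi> \<le> C * r" "g > 0"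
  shows "distinct_vectors (reduced C g r \<phi>) \<longleftrightarrow> satisfiable \<phi>"
proof -
  have "length \<phi> + g \<le> 2 ^ bit_length (g + C * r)"
    using bit_length_le_iff[of "g + C * r" "bit_length (g + C * r)"] assms(2) by simp
  then show ?thesis
    using distinct_vectors_if_satisfiable[OF assms(1,3) num_blocks_bounds(1)[OF assms(3)]]
      satisfiable_if_distinct_vectors unfolding reduced_def Let_def by blast
qed

lemma wp_reduction:
  assumes \<phi>: "is_3cnf r \<phi>" and g: "g > 0" and h: "h = mem (initial (encode_cnf (r, \<phi>)))"
    and Q: "\<And>R' t. R' rOff = 2 + 4 * length \<phi> \<Longrightarrow> t \<le> reduction_time C g r \<Longrightarrow>
      Q R' (written h (2 + 4 * length \<phi>) (encode_dv (reduced C g r \<phi>))) t"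
  shows "wp (reduction C g) Q (\<lambda>_. 0) h"
proof -
  define b where "b = bit_length (g + C * r)"
  define S :: nat where "S = 2 ^ num_blocks g r"
  define hd where "hd = [g + b, 2 * 2 ^ b, b + g * S]"
  have out: "encode_dv (reduced C g r \<phi>) = hd @ concat (map (row_word g b S \<phi>) (row_ids (2 ^ b)))"
    by (simp add: reduced_def Let_def encode_dv_matrix hd_def b_def S_def row_word_def[abs_def])
  show ?thesis
    unfolding reduction_def
    apply (simp only: wp_Seq)
    apply (rule wp_load[OF _ h])
     apply simp
    apply (rule wp_round_up)
     apply simp
    apply (rule wp_block_size[OF _ g])
     apply simp
    apply (rule wp_emit_header)
      apply simp
     apply simp
    subgoal for R1 t1 R2 t2 R3 t3 R4 t4
      apply (rule wp_emit_rows[where r = r and \<phi> = \<phi> and ?h0.0 = h and xs = hd and V = "2 ^ b + r" and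
          ys = "encode_dv (reduced C g r \<phi>)"])
      subgoal by simp
      subgoal by simp
      subgoal by simp
      subgoal by (rule h)
      subgoal by (simp add: hd_def b_def S_def)
      subgoal by (simp add: hd_def)
      subgoal by (rule \<phi>)
      subgoal by (simp add: b_def)
      subgoal by simp
      subgoal by (simp add: out b_def S_def)
      subgoal for R5 t5
        using Q[of R5 "t1 + (t2 + (t3 + (t4 + t5)))"]
        by (simp add: reduction_time_def Let_def b_def S_def algebra_simps)
      done
    done
qed

lemma length_encode_cnf_le:
  assumes "is_3cnf r \<phi>"
  shows "length (encode_cnf (r, \<phi>)) \<le> 2 + 4 * length \<phi>"
  using clause_pos_bound[OF assms, of "length \<phi>"] by (simp add: clause_pos_def encode_cnf_def)

text \<open>The program is the compiled reduction followed by the relocated \<open>P\<close>;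
  relocation causes the factor 2.\<close>

lemma decides_via_reduction:
  assumes P: "decides_in_time P encode_dv UNIV distinct_vectors T" and g: "g > 0"
  shows "\<exists>Pr. decides_in_time Pr encode_cnf {(r, \<phi>). is_3cnf r \<phi> \<and> length \<phi> \<le> C * r}
    (\<lambda>(r, \<phi>). satisfiable \<phi>)
    (\<lambda>(r, \<phi>). real (reduction_time C g r) + 2 * T (reduced C g r \<phi>))"
proof -
  define s where "s = clen (reduction C g)"
  define pre where "pre = compile (reduction C g) 0"
  define Pr where "Pr = pre @ concat (map (reloc s) P)"
  have s: "s = length pre" by (simp add: s_def pre_def)
  have "\<exists>t. real t \<le> real (reduction_time C g r) + 2 * T (reduced C g r \<phi>) \<and>
      (let c = (step Pr ^^ t) (initial (encode_cnf (r, \<phi>))) in halted Pr c \<and> (accepting c \<longleftrightarrow> satisfiable \<phi>))"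
    if \<phi>: "is_3cnf r \<phi>" and len: "length \<phi> \<le> C * r" for r \<phi>
  proof -
    let ?inst = "reduced C g r \<phi>"
    let ?w = "encode_cnf (r, \<phi>)"
    define off where "off = 2 + 4 * length \<phi>"
    have "wp (reduction C g)
      (\<lambda>R h t. R rOff = off \<and> h = written (mem (initial ?w)) off (encode_dv ?inst) \<and>
        t \<le> reduction_time C g r) (\<lambda>_. 0) (mem (initial ?w))"
      by (rule wp_reduction[OF \<phi> g refl]) (simp add: off_def)
    from wp_run[OF this wf_reduction, of "concat (map (reloc s) P)"] obtain t R h
      where run: "(step Pr ^^ t) (initial ?w) = Config s R h"
        and R: "R rOff = off" and h: "h = written (mem (initial ?w)) off (encode_dv ?inst)"
        and t: "t \<le> reduction_time C g r" and zero: "\<forall>x. x \<notin> wregs (reduction C g) \<longrightarrow> R x = 0"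
      unfolding Pr_def pre_def s_def by blast
    have "ren x \<notin> wregs (reduction C g)" for x
      using wregs_reduction[of C g] by (auto simp: ren_def)
    then have ren: "R (ren x) = 0" for x using zero by blast
    \<comment> \<open>The input occupies only cells below \<open>off\<close>, so the memory behind
      the output is 0, as in a fresh initial memory.\<close>
    have "h (off + a) = mem (initial (encode_dv ?inst)) a" for a
      using length_encode_cnf_le[OF \<phi>] by (simp add: h written_def initial_def off_def)
    then have rel: "related s off (initial (encode_dv ?inst)) (Config s R h)"
      using R ren by (simp add: initial_def)
    from P obtain t' where t': "real t' \<le> T ?inst"
        "halted P ((step P ^^ t') (initial (encode_dv ?inst)))"
        "accepting ((step P ^^ t') (initial (encode_dv ?inst))) \<longleftrightarrow> distinct_vectors ?inst"
      unfolding decides_in_time_def Let_def by blast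
    note rel' = reloc_run[OF s Pr_def rel, of t']
    have "(step Pr ^^ (t + 2 * t')) (initial ?w) = (step Pr ^^ (2 * t')) (Config s R h)"
      unfolding funpow_add_app run ..
    with reloc_halted[OF s Pr_def rel'] t t' distinct_vectors_reduced[OF \<phi> len g]
    show ?thesis by (intro exI[of _ "t + 2 * t'"]) (simp add: Let_def)
  qed
  then show ?thesis unfolding decides_in_time_def by (intro exI[of _ Pr]) auto
qed

section \<open>Running time\<close>

definition inst_param :: "nat \<Rightarrow> nat \<Rightarrow> nat \<Rightarrow> nat" where
  "inst_param C g r = g + bit_length (g + C * r)"

definition inst_dim :: "nat \<Rightarrow> nat \<Rightarrow> nat \<Rightarrow> nat" where
  "inst_dim C g r = bit_length (g + C * r) + g * 2 ^ num_blocks g r + 2 * 2 ^ bit_length (g + C * r)"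

lemma reduced_dims:
  "snd (reduced C g r \<phi>) = inst_param C g r"
  "dim_col (fst (reduced C g r \<phi>)) + dim_row (fst (reduced C g r \<phi>)) = inst_dim C g r"
  by (simp_all add: reduced_def Let_def inst_param_def inst_dim_def dv_matrix_def)

text \<open>\<open>W\<close> is linear in \<open>r\<close> and majorizes \<open>g\<close>,
  \<open>b\<close> and \<open>2 ^ b + r\<close>; its factor 3 leaves room for
  \<open>2 ^ b \<le> 2 * (g + C * r)\<close>. \<open>S\<close> carries the exponential
  growth.\<close>

context
  fixes C g r W S b :: nat
  assumes g: "g > 0"
  defines "W \<equiv> (3 * g + 3 * C + 1) * (r + 1)" and "S \<equiv> 2 ^ num_blocks g r" and "b \<equiv> bit_length (g + C * r)"
begin

private lemma size_bounds: "1 \<le> W" "g \<le> W" "b \<le> W" "2 ^ b + r \<le> W" "2 ^ b \<le> W" "1 \<le> S"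
    "C + g + C * r + r \<le> W"
proof -
  have b2: "2 ^ b \<le> 2 * (g + C * r)" using power_bit_length_le[of "g + C * r"] g by (simp add: b_def)
  have W: "W = 3 * g + 3 * C + 1 + r + 3 * (g * r) + 3 * (C * r)" by (simp add: W_def algebra_simps)
  show "1 \<le> W" "g \<le> W" "C + g + C * r + r \<le> W" unfolding W by simp_all
  show "2 ^ b + r \<le> W" "2 ^ b \<le> W" using b2 unfolding W by simp_all
  show "b \<le> W" using bit_length_le[of "g + C * r"] unfolding W b_def by simp
  show "1 \<le> S" by (simp add: S_def)
qed

text \<open>\<open>linarith\<close> treats products as atoms; these inequalities let it absorb lower
  monomials into higher ones.\<close>

private lemma mono_W: "1 \<le> W * S" "W \<le> W * S" "W * S \<le> W * W * S" "W \<le> W * W * S" "1 \<le> W * W * S"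
    "W \<le> W * W * W * S"
proof -
  show 1: "W \<le> W * S" using size_bounds(6) by simp
  show 2: "W * S \<le> W * W * S" using size_bounds(1) by simp
  show 3: "W \<le> W * W * S" using 1 2 by linarith
  have "W * W * S \<le> W * (W * W * S)" using size_bounds(1) by simp
  then show "W \<le> W * W * W * S" using 3 by (simp add: mult.assoc)
  show "1 \<le> W * S" "1 \<le> W * W * S" using 1 3 size_bounds(1) by linarith+
qed

text \<open>An entry costs \<open>O(W)\<close>; there are \<open>S\<close> assignments for each of
  \<open>g \<le> W\<close> groups and two rows for each of \<open>2 ^ b \<le> W\<close> tags. The
  constants are generous.\<close>

lemma reduction_time_bound: "reduction_time C g r \<le> 700 * W ^ 3 * S"
proof -
  let ?V = "2 ^ b + r"
  have "test_time ?V \<le> 230 * W" using size_bounds by (simp add: test_time_def)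
  then have "S * (test_time ?V + 7) \<le> S * (237 * W)" using size_bounds by (intro mult_le_mono2) linarith
  moreover have "S * (237 * W) = 237 * (W * S)" by simp
  ultimately have grp: "group_time ?V S \<le> 239 * (W * S)"
    using mono_W(1) unfolding group_time_def by linarith
  then have "g * (group_time ?V S + 4) \<le> W * (243 * (W * S))"
    using mono_W(1) by (intro mult_le_mono size_bounds) linarith
  moreover have "W * (243 * (W * S)) = 243 * (W * W * S)" by simp
  ultimately have row: "row_time ?V g b S \<le> 259 * (W * W * S)"
    using mono_W(4,5) size_bounds(3) unfolding row_time_def by linarith
  have "7 + 2 * (x + 4) + 4 \<le> 537 * z" if "x \<le> 259 * z" "1 \<le> z" for x z :: nat
    using that by simp
  from this[OF row mono_W(5)] have "tag_time ?V g b S + 4 \<le> 537 * (W * W * S)"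
    by (simp only: tag_time_def)
  then have "2 ^ b * (tag_time ?V g b S + 4) \<le> W * (537 * (W * W * S))"
    using size_bounds(5) by (intro mult_le_mono)
  moreover have "reduction_time C g r \<le> 70 * W + 2 ^ b * (tag_time ?V g b S + 4)"
    using size_bounds(1,7) by (simp add: reduction_time_def Let_def b_def S_def)
  moreover have "W * (537 * (W * W * S)) = 537 * (W * W * W * S)" by simp
  ultimately have "reduction_time C g r \<le> 607 * (W * W * W * S)"
    using mono_W(6) by linarith
  then show ?thesis by (simp add: power3_eq_cube mult.assoc)
qed

lemma inst_dim_bounds: "1 \<le> inst_dim C g r" "inst_dim C g r \<le> 4 * W * S"
proof -
  have "g * S \<le> W * S" using size_bounds(2) by simp
  then show "inst_dim C g r \<le> 4 * W * S"
    using size_bounds(3,5) mono_W(2) unfolding inst_dim_def S_def[symmetric] b_def[symmetric] by linarith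
  have "1 \<le> (2 :: nat) ^ bit_length (g + C * r)" by simp
  then show "1 \<le> inst_dim C g r" unfolding inst_dim_def by linarith
qed

text \<open>Rounding \<open>r / g\<close> up adds less than 1 to the exponent.\<close>

lemma block_bound: "real S \<le> 2 * 2 powr (r / g)"
proof -
  have "real (num_blocks g r) \<le> r / g + 1"
  proof -
    have "real (g * num_blocks g r) \<le> real (r + g)" using num_blocks_bounds(2)[OF g, of r] by linarith
    then show ?thesis using g by (simp add: field_simps)
  qed
  then have "2 powr real (num_blocks g r) \<le> 2 powr (r / g + 1)" by simp
  then show ?thesis by (simp add: S_def powr_realpow powr_add)
qed

text \<open>The parameter \<open>k\<close> is logarithmic in \<open>r\<close>, so
  \<open>2 powr (k / 2)\<close> is only \<open>O(sqrt r)\<close>.\<close>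

lemma inst_param_bound: "(2 :: real) ^ inst_param C g r \<le> 2 ^ g * W"
proof -
  have "(2 :: nat) ^ inst_param C g r \<le> 2 ^ g * W"
    using size_bounds(5) by (simp add: inst_param_def power_add b_def)
  then have "real (2 ^ inst_param C g r) \<le> real (2 ^ g * W)" by (simp only: of_nat_le_iff)
  then show ?thesis by simp
qed

end

section \<open>Asymptotic bounds\<close>

text \<open>Needed because the bound on \<open>f\<close> holds only for large parameters.\<close>

lemma inst_param_at_top:
  assumes "C > 0" shows "filterlim (inst_param C g) at_top at_top"
  unfolding filterlim_at_top eventually_at_top_linorder
proof (intro allI exI impI)
  fix n r :: nat assume r: "2 ^ n \<le> r"
  have "r \<le> C * r" using assms by simp
  also have "C * r \<le> 2 ^ bit_length (g + C * r)"
    using bit_length_le_iff[of "g + C * r" "bit_length (g + C * r)"] by simp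
  finally have "(2 :: nat) ^ n \<le> 2 ^ bit_length (g + C * r)" using r by linarith
  then have "n \<le> bit_length (g + C * r)" by (rule power_le_imp_le_exp[rotated]) simp
  then show "n \<le> inst_param C g r" by (simp add: inst_param_def)
qed

text \<open>\<open>D\<close> is the sum of the absolute values of the coefficients, since
  \<open>x ^ i \<le> x ^ degree p\<close> for \<open>x \<ge> 1\<close>.\<close>

lemma poly_le_power:
  fixes p :: "real poly"
  shows "\<exists>D\<ge>0. \<forall>x\<ge>1. \<bar>poly p x\<bar> \<le> D * x ^ degree p"
proof (intro exI conjI allI impI)
  fix x :: real assume x: "x \<ge> 1"
  have "\<bar>poly p x\<bar> \<le> (\<Sum>i\<le>degree p. \<bar>coeff p i * x ^ i\<bar>)"
    unfolding poly_altdef by (rule sum_abs)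
  also have "\<dots> \<le> (\<Sum>i\<le>degree p. \<bar>coeff p i\<bar> * x ^ degree p)"
    using x by (intro sum_mono) (simp add: abs_mult mult_left_mono power_increasing)
  finally show "\<bar>poly p x\<bar> \<le> (\<Sum>i\<le>degree p. \<bar>coeff p i\<bar>) * x ^ degree p"
    by (simp add: sum_distrib_right)
qed (simp add: sum_nonneg)

text \<open>Written as a power of 2, the left side has an exponent in \<open>o(r)\<close>, which is
  eventually below \<open>e * r\<close>.\<close>

lemma subexponential_bound:
  fixes F e :: real
  assumes "e > 0"
  shows "(\<lambda>r. real (r + 1) ^ d * 2 powr (F * sqrt (real (r + 1)))) \<in> O(\<lambda>r. 2 powr (e * real r))"
proof -
  have "(\<lambda>r. real d * log 2 (real (r + 1)) + F * sqrt (real (r + 1))) \<in> o(\<lambda>r. real r)"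
  proof (rule sum_in_smallo)
    have "(\<lambda>r. log 2 (real (r + 1))) \<in> o(\<lambda>r. real r)" by real_asymp
    then show "(\<lambda>r. real d * log 2 (real (r + 1))) \<in> o(\<lambda>r. real r)" by (cases "d = 0") simp_all
    have "(\<lambda>r. sqrt (real (r + 1))) \<in> o(\<lambda>r. real r)" by real_asymp
    then show "(\<lambda>r. F * sqrt (real (r + 1))) \<in> o(\<lambda>r. real r)" by (cases "F = 0") simp_all
  qed
  from landau_o.smallD[OF this assms]
  have "\<forall>\<^sub>F r in sequentially. norm (real (r + 1) ^ d * 2 powr (F * sqrt (real (r + 1)))) \<le> 1 * norm (2 powr (e * real r))"
  proof eventually_elim
    case (elim r)
    have "real (r + 1) ^ d = 2 powr (real d * log 2 (real (r + 1)))"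
      by (simp add: powr_realpow[symmetric] powr_powr[symmetric] mult.commute[of "real d"])
    then have "real (r + 1) ^ d * 2 powr (F * sqrt (real (r + 1)))
        = 2 powr (real d * log 2 (real (r + 1)) + F * sqrt (real (r + 1)))"
      by (simp add: powr_add)
    also have "\<dots> \<le> 2 powr (e * real r)" using elim by (intro powr_mono) auto
    finally show ?case by simp
  qed
  then show ?thesis by (rule bigoI)
qed

text \<open>The choice of \<open>g\<close> makes both exponential factors,
  \<open>2 powr (r / g)\<close> from the reduction and its \<open>degree p\<close>-th power from
  \<open>p\<close>, at most \<open>2 powr (\<delta> / 2 * r)\<close>. The other half of \<delta>
  absorbs the polynomial factors and, thanks to \<open>c \<le> 1 / 2\<close>, the factor
  \<open>2 powr O(sqrt r)\<close> from \<open>f\<close>.\<close>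

lemma total_time_bound:
  fixes p :: "real poly" and c \<delta> :: real
  assumes f: "f \<in> O(\<lambda>k. 2 powr (c * real k))" and c: "c \<le> 1 / 2" and \<delta>: "\<delta> > 0" and C: "C > 0"
    and g: "real g \<ge> 2 * real (degree p + 1) / \<delta>"
  shows "(\<lambda>r. real (reduction_time C g r) +
      2 * (2 powr f (inst_param C g r) * poly p (real (inst_dim C g r)))) \<in> O(\<lambda>r. 2 powr (\<delta> * real r))"
proof -
  define d where "d = degree p"
  define K where "K = 3 * g + 3 * C + 1"
  have "0 < 2 * real (degree p + 1) / \<delta>" using \<delta> by (intro divide_pos_pos) auto
  with g have g0: "g > 0" by linarith
  have d1: "(real d + 1) / real g \<le> \<delta> / 2"
    using g \<delta> g0 by (simp add: field_simps d_def)
  have "1 / real g \<le> (real d + 1) / real g" "real d / real g \<le> (real d + 1) / real g"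
    by (intro divide_right_mono; simp)+
  with d1 have exps: "1 / real g \<le> \<delta> / 2" "real d / real g \<le> \<delta> / 2" by linarith+
  have Wr: "real ((3 * g + 3 * C + 1) * (r + 1)) = real K * real (r + 1)" for r
    by (simp only: K_def of_nat_mult)
  have half: "\<delta> / 2 > 0" using \<delta> by simp
  have combine: "(\<lambda>r. real (r + 1) ^ n * 2 powr (F * sqrt (real (r + 1))) * 2 powr (\<delta> / 2 * real r))
      \<in> O(\<lambda>r. 2 powr (\<delta> * real r))" for n F
  proof -
    have "(\<lambda>r. real (r + 1) ^ n * 2 powr (F * sqrt (real (r + 1))) * 2 powr (\<delta> / 2 * real r))
      \<in> O(\<lambda>r. 2 powr (\<delta> / 2 * real r) * 2 powr (\<delta> / 2 * real r))"
      by (intro landau_o.big.mult subexponential_bound half landau_o.big_refl)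
    moreover have "2 powr (\<delta> / 2 * real r) * 2 powr (\<delta> / 2 * real r) = 2 powr (\<delta> * real r)" for r
      by (simp add: powr_add[symmetric])
    ultimately show ?thesis by simp
  qed
  have block: "2 ^ num_blocks g r \<le> 2 * 2 powr (real r / real g)" for r
    using block_bound[OF g0, of r] by simp
  \<comment> \<open>The factor with exponent 0 gives the bound the shape of \<open>combine\<close>
    with \<open>F = 0\<close>.\<close>
  have "(\<lambda>r. real (reduction_time C g r)) \<in> O(\<lambda>r. real (r + 1) ^ 3 * 2 powr (0 * sqrt (real (r + 1))) * 2 powr (\<delta> / 2 * real r))"
  proof (intro bigoI[where c = "1400 * real K ^ 3"] always_eventually allI)
    fix r
    have "real (reduction_time C g r) \<le> real (700 * ((3 * g + 3 * C + 1) * (r + 1)) ^ 3 * 2 ^ num_blocks g r)"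
      using reduction_time_bound[OF g0, of C r] by (simp only: of_nat_le_iff)
    also have "\<dots> = 700 * (real K * real (r + 1)) ^ 3 * 2 ^ num_blocks g r"
      by (simp only: of_nat_mult of_nat_power Wr[unfolded of_nat_mult] of_nat_numeral)
    also have "\<dots> \<le> 700 * (real K * real (r + 1)) ^ 3 * (2 * 2 powr (\<delta> / 2 * real r))"
    proof -
      have "real r / real g \<le> \<delta> / 2 * real r"
        using mult_right_mono[OF exps(1), of "real r"] by simp
      then have "2 powr (real r / real g) \<le> 2 powr (\<delta> / 2 * real r)" by simp
      with block[of r] have "2 ^ num_blocks g r \<le> 2 * 2 powr (\<delta> / 2 * real r)" by linarith
      then show ?thesis by (rule mult_left_mono) simp
    qed
    finally show "norm (real (reduction_time C g r)) \<le> 1400 * real K ^ 3 *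
        norm (real (r + 1) ^ 3 * 2 powr (0 * sqrt (real (r + 1))) * 2 powr (\<delta> / 2 * real r))"
      by (simp add: power_mult_distrib mult_ac)
  qed
  from this combine have red: "(\<lambda>r. real (reduction_time C g r)) \<in> O(\<lambda>r. 2 powr (\<delta> * real r))"
    by (rule landau_o.big_trans)
  obtain D where D: "D \<ge> 0" "\<And>x. x \<ge> 1 \<Longrightarrow> \<bar>poly p x\<bar> \<le> D * x ^ d"
    using poly_le_power[of p] unfolding d_def by blast
  from f obtain F where F: "F > 0" "\<forall>\<^sub>F k in at_top. norm (f k) \<le> F * norm (2 powr (c * real k))"
    by (rule landau_o.bigE)
  \<comment> \<open>From \<open>f k \<le> F * sqrt (2 ^ k)\<close> and
    \<open>2 ^ k \<le> 2 ^ g * K * (r + 1)\<close>.\<close>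
  define G where "G = F * sqrt (2 ^ g * K)"
  have ev: "\<forall>\<^sub>F r in at_top. norm (f (inst_param C g r)) \<le> F * norm (2 powr (c * real (inst_param C g r)))"
    using F(2) inst_param_at_top[OF C] by (rule eventually_compose_filterlim)
  have "(\<lambda>r. 2 powr f (inst_param C g r) * poly p (real (inst_dim C g r)))
      \<in> O(\<lambda>r. real (r + 1) ^ d * 2 powr (G * sqrt (real (r + 1))) * 2 powr (\<delta> / 2 * real r))"
  \<comment> \<open>The dimension is at most \<open>4 * W * S\<close>, and \<open>S\<close>
    contributes another factor 2, hence the 8.\<close>
  proof (intro bigoI[where c = "D * (8 * real K) ^ d"])
    show "\<forall>\<^sub>F r in sequentially. norm (2 powr f (inst_param C g r) * poly p (real (inst_dim C g r))) \<le>
      D * (8 * real K) ^ d *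
      norm (real (r + 1) ^ d * 2 powr (G * sqrt (real (r + 1))) * 2 powr (\<delta> / 2 * real r))"
      using ev
    proof eventually_elim
      case (elim r)
      let ?k = "inst_param C g r" and ?N = "real (inst_dim C g r)"
      have "f ?k \<le> F * 2 powr (c * real ?k)" using elim by simp
      also have "\<dots> \<le> F * 2 powr (1 / 2 * real ?k)"
        using c F(1) by (intro mult_left_mono powr_mono mult_right_mono) auto
      also have "2 powr (1 / 2 * real ?k) = sqrt (2 ^ ?k)"
        by (simp add: powr_half_sqrt[symmetric] powr_powr powr_realpow[symmetric] mult.commute)
      also have "F * sqrt (2 ^ ?k) \<le> F * sqrt (2 ^ g * (real K * real (r + 1)))"
      proof -
        have "2 ^ ?k \<le> 2 ^ g * (real K * real (r + 1))"
          using inst_param_bound[OF g0, of C r] by (simp only: K_def of_nat_mult of_nat_power of_nat_numeral)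
        then show ?thesis using F(1) by (intro mult_left_mono real_sqrt_le_mono) auto
      qed
      also have "\<dots> = G * sqrt (real (r + 1))" by (simp add: G_def real_sqrt_mult)
      finally have 1: "2 powr f ?k \<le> 2 powr (G * sqrt (real (r + 1)))" by simp
      have N1: "1 \<le> ?N" using inst_dim_bounds(1)[OF g0, of C r] by linarith
      have "?N \<le> real (4 * ((3 * g + 3 * C + 1) * (r + 1)) * 2 ^ num_blocks g r)"
        using inst_dim_bounds(2)[OF g0, of C r] by (simp only: of_nat_le_iff)
      also have "\<dots> = 4 * (real K * real (r + 1)) * 2 ^ num_blocks g r"
        by (simp only: of_nat_mult of_nat_power Wr[unfolded of_nat_mult] of_nat_numeral)
      also have "\<dots> \<le> 4 * (real K * real (r + 1)) * (2 * 2 powr (real r / real g))"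
        using block[of r] by (intro mult_left_mono) auto
      finally have "?N \<le> 8 * real K * real (r + 1) * 2 powr (real r / real g)"
        by (simp only: mult_ac)
      then have "?N ^ d \<le> (8 * real K * real (r + 1) * 2 powr (real r / real g)) ^ d"
        by (intro power_mono) auto
      also have "\<dots> = (8 * real K) ^ d * real (r + 1) ^ d * 2 powr (real d / real g * real r)"
      proof -
        have "(2 powr (real r / real g)) ^ d = 2 powr (real d / real g * real r)"
          by (simp add: powr_power mult.commute)
        then show ?thesis by (simp only: power_mult_distrib)
      qed
      also have "\<dots> \<le> (8 * real K) ^ d * real (r + 1) ^ d * 2 powr (\<delta> / 2 * real r)"
        using exps(2) by (intro mult_left_mono powr_mono mult_right_mono) auto
      finally have "D * ?N ^ d \<le> D * ((8 * real K) ^ d * real (r + 1) ^ d * 2 powr (\<delta> / 2 * real r))"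
        using D(1) by (rule mult_left_mono)
      with D(2)[OF N1] have "\<bar>poly p ?N\<bar> \<le> D * ((8 * real K) ^ d * real (r + 1) ^ d * 2 powr (\<delta> / 2 * real r))"
        by linarith
      with 1 have "2 powr f ?k * \<bar>poly p ?N\<bar> \<le> 2 powr (G * sqrt (real (r + 1))) *
          (D * ((8 * real K) ^ d * real (r + 1) ^ d * 2 powr (\<delta> / 2 * real r)))"
        by (intro mult_mono) auto
      then show ?case by (simp add: abs_mult mult_ac)
    qed
  qed
  from this combine have "(\<lambda>r. 2 powr f (inst_param C g r) * poly p (real (inst_dim C g r))) \<in> O(\<lambda>r. 2 powr (\<delta> * real r))"
    by (rule landau_o.big_trans)
  with red show ?thesis by (intro sum_in_bigo) simp_all
qed

theorem theorem1:
  fixes \<epsilon> c :: real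
  assumes "\<epsilon> > 0" and "c = 1 / 2 - \<epsilon>"
    and "\<exists>(P :: program) (f :: nat \<Rightarrow> real) (p :: real poly).
           f \<in> O(\<lambda>k. 2 powr (c * real k)) \<and>
           decides_in_time P encode_dv UNIV distinct_vectors
             (\<lambda>(A, k). 2 powr (f k) * poly p (real (dim_col A + dim_row A)))"
  shows "\<not> ETH"
proof -
  obtain P :: program and f :: "nat \<Rightarrow> real" and p :: "real poly"
    where f: "f \<in> O(\<lambda>k. 2 powr (c * real k))"
      and P: "decides_in_time P encode_dv UNIV distinct_vectors
             (\<lambda>(A, k). 2 powr (f k) * poly p (real (dim_col A + dim_row A)))"
    using assms(3) by blast
  have "\<exists>Pr T. T \<in> O(\<lambda>r. 2 powr (\<delta> * real r)) \<and>
      decides_in_time Pr encode_cnf {(r, \<phi>). is_3cnf r \<phi> \<and> real (length \<phi>) \<le> C * real r}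
        (\<lambda>(r, \<phi>). satisfiable \<phi>) (\<lambda>(r, \<phi>). T r)"
    if \<delta>: "\<delta> > 0" and C: "C > 0" for \<delta> C :: real
  proof -
    \<comment> \<open>The program needs a natural number; rounding \<open>C\<close> up only enlarges
      the set of promised formulas.\<close>
    define C' where "C' = nat \<lceil>C\<rceil>"
    have C': "C' > 0" "C \<le> real C'" using C by (auto simp: C'_def)
    \<comment> \<open>\<open>g\<close> depends on \<delta> and \<open>p\<close> but not on the
      formula, so it can be built into the program.\<close>
    obtain g :: nat where g: "real g \<ge> 2 * real (degree p + 1) / \<delta>" using real_arch_simple by blast
    moreover have "0 < 2 * real (degree p + 1) / \<delta>" using \<delta> by (intro divide_pos_pos) auto
    ultimately have g0: "g > 0" by linarith
    define T where "T r = real (reduction_time C' g r) +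
      2 * (2 powr f (inst_param C' g r) * poly p (real (inst_dim C' g r)))" for r
    from decides_via_reduction[OF P g0, of C'] obtain Pr where
      Pr: "decides_in_time Pr encode_cnf {(r, \<phi>). is_3cnf r \<phi> \<and> length \<phi> \<le> C' * r}
        (\<lambda>(r, \<phi>). satisfiable \<phi>) (\<lambda>(r, \<phi>). real (reduction_time C' g r) +
          2 * (\<lambda>(A, k). 2 powr (f k) * poly p (real (dim_col A + dim_row A))) (reduced C' g r \<phi>))" ..
    \<comment> \<open>Parameter and dimensions of the reduced instance depend only on
      \<open>r\<close>, so the time bound is a function of \<open>r\<close>, as \<open>ETH\<close>
      demands.\<close>
    have "real (reduction_time C' g r) +
        2 * (\<lambda>(A, k). 2 powr (f k) * poly p (real (dim_col A + dim_row A))) (reduced C' g r \<phi>) = T r" for r \<phi>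
      by (simp only: case_prod_beta reduced_dims T_def)
    with Pr have Pr': "decides_in_time Pr encode_cnf {(r, \<phi>). is_3cnf r \<phi> \<and> length \<phi> \<le> C' * r}
        (\<lambda>(r, \<phi>). satisfiable \<phi>) (\<lambda>(r, \<phi>). T r)" by simp
    have "length \<phi> \<le> C' * r" if "real (length \<phi>) \<le> C * real r" for \<phi> :: cnf and r
    proof -
      have "C * real r \<le> real C' * real r" using C'(2) by (intro mult_right_mono) auto
      with that have "real (length \<phi>) \<le> real (C' * r)" by simp
      then show ?thesis by (simp only: of_nat_le_iff)
    qed
    with Pr' have "decides_in_time Pr encode_cnf {(r, \<phi>). is_3cnf r \<phi> \<and> real (length \<phi>) \<le> C * real r}
        (\<lambda>(r, \<phi>). satisfiable \<phi>) (\<lambda>(r, \<phi>). T r)"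
      unfolding decides_in_time_def by blast
    moreover have "T \<in> O(\<lambda>r. 2 powr (\<delta> * real r))"
      unfolding T_def using assms(1,2) by (intro total_time_bound[OF f _ \<delta> C'(1) g]) simp
    ultimately show ?thesis by blast
  qed
  then show ?thesis unfolding ETH_def by blast
qed

end
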